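(* Let $n\ge 5$. Then for every $u\in C_0^\infty(\mathbb{H}^n)$, $$\int_{\mathbb{H}^n}(\Delta_g u)^2\,dV_g-\frac{(n-1)^4}{16}\int_{\mathbb{H}^n}u^2\,dV_g\ \ge\ \frac{n^2(n-4)^2}{16}\int_{\mathbb{H}^n}\frac{u(x)^2}{\left(\frac{V_g(B_g(0,\rho(x)))}{\sigma_n}\right)^{4/n}}\,dV_g .$$ Moreover, the constant $\frac{n^2(n-4)^2}{16}$ on the right-hand side is sharp, i.e. the inequality fails for some $u\in C_0^\infty(\mathbb{H}^n)$ if this constant is replaced by any larger number.
   Context: $\mathbb{H}^n$ is the hyperbolic space in the Poincaré ball model: the open unit ball $\{x\in\mathbb{R}^n:|x|<1\}$ with the metric $g(x)=\left(\frac{2}{1-|x|^2}\right)^2\sum_{i=1}^n dx_i^2$. Its volume element is $dV_g=\left(\frac{2}{1-|x|^2}\right)^n dx$, and its Laplace–Beltrami operator is $\Delta_g=\left(\frac{1-|x|^2}{2}\right)^2\Delta+(n-2)\frac{1-|x|^2}{2}\langle x,\nabla\rangle$, where $\Delta$, $\nabla$, $\langle\cdot,\cdot\rangle$ are the Euclidean Laplacian, gradient and scalar product. $\rho(x)=\ln\frac{1+|x|}{1-|x|}$ is the geodesic distance from $0$ to $x$. $B_g(0,r)$ is the geodesic ball centered at $0$ with radius $r>0$, and $V_g(B_g(0,r))=n\sigma_n\int_0^r\sinh^{n-1}(s)\,ds$ is its volume, where $\sigma_n$ is the volume of the unit ball in $\mathbb{R}^n$. $C_0^\infty(\mathbb{H}^n)$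 is the space of smooth compactly supported real-valued functions on $\mathbb{H}^n$. *)

theory Defs
  imports "HOL-Analysis.Analysis"
begin

definition partial_deriv :: "'n::finite \<Rightarrow> (real^'n \<Rightarrow> real) \<Rightarrow> real^'n \<Rightarrow> real" where
  "partial_deriv i f x = deriv (\<lambda>t. f (x + t *\<^sub>R axis i 1)) 0"

definition gradient :: "(real^'n::finite \<Rightarrow> real) \<Rightarrow> real^'n \<Rightarrow> real^'n" where
  "gradient f x = (\<chi> i. partial_deriv i f x)"

definition laplacian :: "(real^'n::finite \<Rightarrow> real) \<Rightarrow> real^'n \<Rightarrow> real" where
  "laplacian f x = (\<Sum>i\<in>UNIV. partial_deriv i (partial_deriv i f) x)"

text \<open>Class $C^k$ on a set, intended for open sets only.\<close>

primrec Ck_on :: "nat \<Rightarrow> (real^'n::finite) set \<Rightarrow> (real^'n \<Rightarrow> real) \<Rightarrow> bool" where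
  "Ck_on 0 S f \<longleftrightarrow> continuous_on S f"
| "Ck_on (Suc k) S f \<longleftrightarrow>
     (\<forall>x\<in>S. f differentiable (at x)) \<and> (\<forall>i. Ck_on k S (partial_deriv i f))"

definition smooth_on :: "(real^'n::finite) set \<Rightarrow> (real^'n \<Rightarrow> real) \<Rightarrow> bool" where
  "smooth_on S f \<longleftrightarrow> (\<forall>k. Ck_on k S f)"

text \<open>The Poincare ball model of hyperbolic space: the underlying set is \<open>ball 0 1\<close>.\<close>

text \<open>A test function on the open ball is identified with its extension by zero to the
  whole of Euclidean space.\<close>

definition hyp_test_functions :: "(real^'n::finite \<Rightarrow> real) set" where
  "hyp_test_functions =
     {u. smooth_on (ball 0 1) u \<and>
         compact (closure {x. u x \<noteq> 0}) \<and> closure {x. u x \<noteq> 0} \<subseteq> ball 0 1}"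

definition hyp_vol :: "(real^'n::finite) measure" where
  "hyp_vol = density (restrict_space lborel (ball 0 1))
               (\<lambda>x. ennreal ((2 / (1 - (norm x)\<^sup>2)) ^ CARD('n)))"

definition hyp_laplacian :: "(real^'n::finite \<Rightarrow> real) \<Rightarrow> real^'n \<Rightarrow> real" where
  "hyp_laplacian u x =
     ((1 - (norm x)\<^sup>2) / 2)\<^sup>2 * laplacian u x
     + (real CARD('n) - 2) * ((1 - (norm x)\<^sup>2) / 2) * (x \<bullet> gradient u x)"

text \<open>Geodesic distance from the origin.\<close>

definition hyp_rho :: "real^'n::finite \<Rightarrow> real" where
  "hyp_rho x = ln ((1 + norm x) / (1 - norm x))"

text \<open>Geodesic ball centred at the origin.\<close>

definition hyp_ball :: "real \<Rightarrow> (real^'n::finite) set" where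
  "hyp_ball r = {x \<in> ball 0 1. hyp_rho x < r}"

text \<open>The quotient of the volume of the geodesic ball with radius \<open>hyp_rho x\<close> by the Euclidean
  volume of the unit ball. It vanishes only at the origin, a null set.\<close>

definition hyp_ball_vol_ratio :: "real^'n::finite \<Rightarrow> real" where
  "hyp_ball_vol_ratio x =
     measure hyp_vol (hyp_ball (hyp_rho x) :: (real^'n) set)
       / measure lborel (ball (0 :: real^'n) 1)"

end

theory Submission
  imports Defs "HOL-Computational_Algebra.Polynomial"
begin

text \<open>
  Write \<open>r\<close> for the geodesic distance from the origin, \<open>L = -\<Delta>\<^sub>g\<close>, \<open>\<kappa> = n(n-4)/4\<close>,
  \<open>\<beta> = (n-1)\<^sup>2/4\<close> and \<open>z = sinh\<^sup>-\<^sup>2 r\<close>. If \<open>\<phi>\<close> and \<open>\<theta>\<close> are positive, \<open>L\<phi> \<ge> \<theta>\<close> and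
  \<open>L\<theta> \<ge> V\<phi>\<close>, then \<open>\<integral>(Lu)\<^sup>2 \<ge> \<integral>V u\<^sup>2\<close>: pointwise \<open>(Lu)\<^sup>2 \<ge> 2quLu - q\<^sup>2u\<^sup>2\<close> with
  \<open>q = \<theta>/\<phi>\<close>, and integrating by parts with \<open>|\<nabla>u - u\<nabla>\<phi>/\<phi>|\<^sup>2 \<ge> 0\<close> gives the claim. The choice
  \<open>\<theta> = sinh\<^sup>-\<^sup>(\<^sup>n\<^sup>-\<^sup>1\<^sup>)\<^sup>/\<^sup>2 r coth\<^sup>1\<^sup>/\<^sup>2 r\<close>, \<open>\<phi> = \<theta>/(\<beta> + \<kappa>z)\<close> works for \<open>V = \<beta>\<^sup>2 + \<kappa>\<^sup>2z(z+1)\<close>, and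
  the volume ratio is at least \<open>sinh\<^sup>n r cosh\<^sup>-\<^sup>n\<^sup>/\<^sup>2 r\<close>, so its power \<open>-4/n\<close> is at most
  \<open>z(z+1)\<close>. The singularities at the origin are harmless because \<open>|x|\<^sup>-\<^sup>4\<close> is integrable for
  \<open>n \<ge> 5\<close>.

  For sharpness take \<open>u = (|x|\<^sup>2 + \<epsilon>)\<^sup>-\<^sup>(\<^sup>n\<^sup>-\<^sup>4\<^sup>)\<^sup>/\<^sup>4\<close> times a fixed bump function. The Euclidean Laplacian of
  the first factor is bounded by \<open>\<kappa>/|x|\<^sup>2\<close> times that factor in absolute value, and
  \<open>\<integral>(|x|\<^sup>2 + \<epsilon>)\<^sup>-\<^sup>n\<^sup>/\<^sup>2\<close> over a small ball diverges as \<open>\<epsilon> \<rightarrow> 0\<close>, while all error terms stay bounded.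
\<close>

section \<open>Integration over Euclidean space\<close>

lemma integrable_compact_support:
  fixes f :: "'a::euclidean_space \<Rightarrow> real"
  assumes "continuous_on UNIV f" and "\<And>x. norm x > r \<Longrightarrow> f x = 0"
  shows "integrable lborel f"
proof -
  have "integrable lborel (\<lambda>x. indicator (cball 0 r) x *\<^sub>R f x)"
    by (rule borel_integrable_compact) (auto intro: continuous_on_subset[OF assms(1)])
  moreover have "(\<lambda>x. indicator (cball 0 r) x *\<^sub>R f x) = f"
    using assms(2) by (auto simp: indicator_def fun_eq_iff)
  ultimately show ?thesis by simp
qed

lemma bounded_compact_support:
  fixes f :: "'a::euclidean_space \<Rightarrow> real"
  assumes "continuous_on UNIV f" and "\<And>x. norm x > r \<Longrightarrow> f x = 0"
  obtains M where "M \<ge> 0" "\<And>x. \<bar>f x\<bar> \<le> M"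
proof -
  have "bounded (f ` cball 0 r)"
    by (intro compact_imp_bounded compact_continuous_image) (auto intro: continuous_on_subset[OF assms(1)])
  then obtain M where M: "\<And>x. x \<in> cball 0 r \<Longrightarrow> \<bar>f x\<bar> \<le> M" unfolding bounded_iff by (metis (no_types, lifting) imageI real_norm_def)
  have "\<bar>f x\<bar> \<le> max M 0" for x
    using M[of x] assms(2)[of x] by (cases "norm x \<le> r") auto
  thus ?thesis using that[of "max M 0"] by auto
qed

text \<open>By translation invariance every forward difference quotient \<open>s k\<close> of
  \<open>f\<close> in direction \<open>v\<close> has integral zero. The mean value theorem bounds
  the quotients by a bound \<open>M\<close> of \<open>g\<close>, and they vanish outside the ball of
  radius \<open>r + norm v\<close>, so dominated convergence carries the zero over to
  \<open>g\<close>. Every integration by parts below rests on this.\<close>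

lemma integral_directional_derivative_eq_0:
  fixes f g :: "'a::euclidean_space \<Rightarrow> real"
  assumes der: "\<And>x. ((\<lambda>t. f (x + t *\<^sub>R v)) has_real_derivative g x) (at 0)"
    and cf: "continuous_on UNIV f" and cg: "continuous_on UNIV g"
    and sf: "\<And>x. norm x > r \<Longrightarrow> f x = 0" and sg: "\<And>x. norm x > r \<Longrightarrow> g x = 0"
  shows "integral\<^sup>L lborel g = 0"
proof -
  define s where "s k x = real (Suc k) * (f (x + (1 / real (Suc k)) *\<^sub>R v) - f x)" for k x
  obtain M where M: "M \<ge> 0" "\<And>x. \<bar>g x\<bar> \<le> M" using bounded_compact_support[OF cg sg] by blast
  have der': "((\<lambda>t. f (x + t *\<^sub>R v)) has_real_derivative g (x + t *\<^sub>R v)) (at t)" for x t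
    using der[of "x + t *\<^sub>R v"] DERIV_shift[of "\<lambda>t. f (x + t *\<^sub>R v)" "g (x + t *\<^sub>R v)" 0 t]
    by (simp add: algebra_simps)
  have s_le: "\<bar>s k x\<bar> \<le> M" for k x
  proof -
    have "norm (f (x + (1 / real (Suc k)) *\<^sub>R v) - f (x + 0 *\<^sub>R v)) \<le> M * norm (1 / real (Suc k) - 0)"
      by (rule field_differentiable_bound[where S = UNIV and f' = "\<lambda>t. g (x + t *\<^sub>R v)"])
        (use der' M in auto)
    hence "\<bar>f (x + (1 / real (Suc k)) *\<^sub>R v) - f x\<bar> \<le> M / real (Suc k)" by simp
    thus ?thesis unfolding s_def abs_mult by (simp add: field_simps del: of_nat_Suc)
  qed
  have s_supp: "s k x = 0" if "norm x > r + norm v" for k x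
  proof -
    have "norm x \<le> norm (x + (1 / real (Suc k)) *\<^sub>R v) + norm ((1 / real (Suc k)) *\<^sub>R v)"
      using norm_triangle_ineq4[of "x + (1 / real (Suc k)) *\<^sub>R v" "(1 / real (Suc k)) *\<^sub>R v"] by simp
    moreover have "norm ((1 / real (Suc k)) *\<^sub>R v) \<le> norm v" 
      by (simp add: divide_le_eq mult_left_le algebra_simps)
    ultimately have "norm (x + (1 / real (Suc k)) *\<^sub>R v) > r" using that by linarith
    moreover have "norm x > r" using that norm_ge_zero[of v] by linarith
    ultimately show ?thesis by (simp add: s_def sf)
  qed
  have if1: "integrable lborel f" by (rule integrable_compact_support[OF cf sf])
  have if2: "integrable lborel (\<lambda>x. f (x + c))" for c
  proof (rule integrable_compact_support[where r = "r + norm c"])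
    show "continuous_on UNIV (\<lambda>x. f (x + c))"
      by (rule continuous_on_compose2[OF cf]) (auto intro!: continuous_intros)
    fix x :: 'a assume "norm x > r + norm c"
    moreover have "norm x \<le> norm (x + c) + norm c" using norm_triangle_ineq4[of "x + c" c] by simp
    ultimately show "f (x + c) = 0" by (intro sf) linarith
  qed
  have shift: "integral\<^sup>L lborel (\<lambda>x. f (x + c)) = integral\<^sup>L lborel f" for c
  proof -
    have "integral\<^sup>L (distr lborel borel ((+) c)) f = integral\<^sup>L lborel (\<lambda>x. f (c + x))"
      by (rule integral_distr) (use if1 in auto)
    thus ?thesis by (simp add: lborel_distr_plus add.commute)
  qed
  have s0: "integral\<^sup>L lborel (s k) = 0" for k
    unfolding s_def using if1 if2 shift by simp
  have "(\<lambda>k. integral\<^sup>L lborel (s k)) \<longlonglongrightarrow> integral\<^sup>L lborel g"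
  proof (rule integral_dominated_convergence)
    show "g \<in> borel_measurable lborel" using cg by (simp add: borel_measurable_continuous_onI)
    show "s k \<in> borel_measurable lborel" for k
      unfolding s_def using if1 if2 by (intro borel_measurable_times borel_measurable_diff) auto
    show "integrable lborel (\<lambda>x. M * indicator (cball (0::'a) (r + norm v)) x)"
      by (intro integrable_mult_right integrable_real_indicator) (auto intro: emeasure_bounded_finite simp flip: infinity_ennreal_def)
    show "AE x in lborel. norm (s k x) \<le> M * indicator (cball 0 (r + norm v)) x" for k
      using s_le[of k] s_supp[of _ k] by (auto simp: indicator_def not_le)
    show "AE x in lborel. (\<lambda>k. s k x) \<longlonglongrightarrow> g x"
    proof (intro AE_I2)
      fix x
      have "(\<lambda>h. (f (x + h *\<^sub>R v) - f x) / h) \<midarrow>0\<rightarrow> g x"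
        using der[of x] by (simp add: DERIV_def)
      moreover have "filterlim (\<lambda>k. 1 / real (Suc k)) (at 0) sequentially"
        using LIMSEQ_inverse_real_of_nat by (auto simp: filterlim_at inverse_eq_divide)
      ultimately have "((\<lambda>k. (f (x + (1 / real (Suc k)) *\<^sub>R v) - f x) / (1 / real (Suc k))) \<longlongrightarrow> g x) sequentially"
        by (rule filterlim_compose)
      thus "(\<lambda>k. s k x) \<longlonglongrightarrow> g x" by (simp add: s_def mult.commute)
    qed
  qed
  thus ?thesis by (simp add: s0 LIMSEQ_const_iff)
qed

text \<open>Dyadic comparison: on the shell between the radii 2^-(j+1) and 2^-j the integrand is at
  most 16 times 16^j, while the ball of radius 2^-j has volume proportional to 2^(-jd). Since d is
  at least 5, a geometric series of ratio 1/2 dominates. At the origin the quotient has the value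
  0.\<close>

lemma integrable_inverse_norm_power4:
  assumes "DIM('a::euclidean_space) \<ge> 5"
  shows "integrable lborel (\<lambda>x::'a. indicator (ball 0 1) x / (x \<bullet> x)\<^sup>2)"
proof (rule integrableI_bounded)
  let ?d = "DIM('a)"
  let ?v = "unit_ball_vol (real ?d)"
  show "(\<lambda>x::'a. indicator (ball 0 1) x / (x \<bullet> x)\<^sup>2) \<in> borel_measurable lborel" by (intro borel_measurable_divide borel_measurable_indicator borel_measurable_power borel_measurable_inner) simp_all
  have pt: "ennreal (norm (indicator (ball (0::'a) 1) x / (x \<bullet> x)\<^sup>2 :: real)) \<le>
      (\<Sum>j. ennreal (16 * 16 ^ j) * indicator (ball (0::'a) ((1/2) ^ j)) x)" for x :: 'a
  proof (cases "x = 0 \<or> norm x \<ge> 1")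
    case True
    hence "(indicator (ball (0::'a) 1) x / (x \<bullet> x)\<^sup>2 :: real) = 0" by (auto simp: indicator_def)
    thus ?thesis by (simp only: norm_zero ennreal_0 zero_le)
  next
    case False
    hence x: "0 < norm x" "norm x < 1" by auto
    obtain m0 where m0: "(1/2::real) ^ m0 < norm x" using real_arch_pow_inv[of "norm x" "1/2"] x by auto
    obtain j where j: "norm x < (1/2) ^ j" "(1/2) ^ Suc j \<le> norm x"
    proof -
      define m where "m = (LEAST m. (1/2::real) ^ m \<le> norm x)"
      have ex: "\<exists>m. (1/2::real) ^ m \<le> norm x" using m0 less_imp_le by blast
      have m1: "(1/2::real) ^ m \<le> norm x" unfolding m_def using ex by (rule LeastI_ex)
      have "m \<noteq> 0" using m1 x by (cases m) auto
      then obtain j where mj: "m = Suc j" by (cases m) auto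
      have "\<not> (1/2::real) ^ j \<le> norm x" using not_less_Least[of j "\<lambda>m. (1/2::real) ^ m \<le> norm x"] mj
        unfolding m_def by auto
      thus ?thesis using that[of j] m1 mj by auto
    qed
    have "(((1/2::real) ^ Suc j)\<^sup>2)\<^sup>2 \<le> ((norm x)\<^sup>2)\<^sup>2" using j by (intro power_mono) auto
    moreover have "(((1/2::real) ^ Suc j)\<^sup>2)\<^sup>2 = 1 / (16 * 16 ^ j)"
    proof -
      have "((2::real) ^ j) ^ 4 = 16 ^ j" using power_mult[of "2::real" 4 j] power_mult[of "2::real" j 4] by (simp add: mult.commute)
      thus ?thesis by (simp add: power_divide power_mult_distrib flip: power_mult) (simp add: mult.commute)
    qed
    ultimately have "1 / (16 * 16 ^ j) \<le> (x \<bullet> x)\<^sup>2" by (simp add: power2_norm_eq_inner)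
    hence "1 / (x \<bullet> x)\<^sup>2 \<le> 16 * 16 ^ j" using x by (simp add: field_simps)
    hence "ennreal (norm (indicator (ball (0::'a) 1) x / (x \<bullet> x)\<^sup>2 :: real)) \<le> ennreal (16 * 16 ^ j) * indicator (ball (0::'a) ((1/2) ^ j)) x"
      using x j by (auto simp: indicator_def intro!: ennreal_leI)
    also have "\<dots> = (\<Sum>i\<in>{j}. ennreal (16 * 16 ^ i) * indicator (ball (0::'a) ((1/2) ^ i)) x)" by (simp only: sum.insert finite.emptyI empty_iff not_False_eq_True sum.empty add_0_right)
    also have "\<dots> \<le> (\<Sum>j. ennreal (16 * 16 ^ j) * indicator (ball (0::'a) ((1/2) ^ j)) x)"
      by (rule sum_le_suminf) auto
    finally show ?thesis .
  qed
  have "(\<integral>\<^sup>+x. ennreal (norm (indicator (ball (0::'a) 1) x / (x \<bullet> x)\<^sup>2 :: real)) \<partial>lborel)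
    \<le> (\<integral>\<^sup>+x. (\<Sum>j. ennreal (16 * 16 ^ j) * indicator (ball (0::'a) ((1/2) ^ j)) x) \<partial>lborel)"
    by (intro nn_integral_mono pt)
  also have "\<dots> = (\<Sum>j. \<integral>\<^sup>+x. ennreal (16 * 16 ^ j) * indicator (ball (0::'a) ((1/2) ^ j)) x \<partial>lborel)"
    by (intro nn_integral_suminf borel_measurable_times_ennreal borel_measurable_indicator) auto
  also have "\<dots> = (\<Sum>j. ennreal (16 * 16 ^ j) * ennreal (?v * ((1/2) ^ j) ^ ?d))"
    by (intro suminf_cong, subst nn_integral_cmult_indicator) (auto simp: emeasure_ball)
  also have "\<dots> = (\<Sum>j. ennreal (16 * 16 ^ j * (?v * ((1/2) ^ j) ^ ?d)))"
    by (intro suminf_cong) (simp add: ennreal_mult)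
  also have "\<dots> \<le> (\<Sum>j. ennreal (16 * ?v * (1/2) ^ j))"
  proof (intro suminf_le ennreal_leI)
    fix j :: nat
    have "((1/2::real) ^ j) ^ ?d \<le> ((1/2) ^ j) ^ 5" using assms
      by (intro power_decreasing) (auto intro: power_le_one)
    also have "\<dots> = (1/2) ^ j * (1/16) ^ j"
    proof -
      have "((1/2::real) ^ j) ^ 4 = (1/16) ^ j" using power_mult[of "1/2::real" 4 j] power_mult[of "1/2::real" j 4]
        by (simp add: mult.commute power_divide)
      thus ?thesis using power_Suc[of "(1/2::real) ^ j" 4] by simp
    qed
    finally have "16 ^ j * ((1/2::real) ^ j) ^ ?d \<le> 16 ^ j * ((1/2) ^ j * (1/16) ^ j)" by simp
    also have "\<dots> = (1/2) ^ j" by (simp add: power_divide)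
    finally have "(16 * ?v) * (16 ^ j * ((1/2::real) ^ j) ^ ?d) \<le> (16 * ?v) * (1/2) ^ j"
      by (intro mult_left_mono) auto
    thus "16 * 16 ^ j * (?v * ((1/2) ^ j) ^ ?d) \<le> 16 * ?v * (1/2) ^ j" by (simp add: mult_ac)
  qed auto
  also have "\<dots> = ennreal (\<Sum>j. 16 * ?v * (1/2) ^ j)"
    by (intro suminf_ennreal2 summable_mult summable_geometric) auto
  also have "\<dots> < \<infinity>" by simp
  finally show "(\<integral>\<^sup>+x. ennreal (norm (indicator (ball (0::'a) 1) x / (x \<bullet> x)\<^sup>2 :: real)) \<partial>lborel) < \<infinity>" .
qed

section \<open>The divergent integral at the critical exponent\<close>

lemma integrable_regularized_norm_power:
  assumes "e > 0" "c \<le> 0"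
  shows "integrable lborel (\<lambda>x. indicator (ball (0::'a::euclidean_space) \<rho>) x * (x \<bullet> x + e) powr c)"
proof (rule Bochner_Integration.integrable_bound)
  show "integrable lborel (\<lambda>x. e powr c * indicator (ball (0::'a) \<rho>) x)"
    by (intro integrable_mult_right integrable_real_indicator) (auto intro: emeasure_bounded_finite simp flip: infinity_ennreal_def)
  have "(x \<bullet> x + e) powr c \<le> e powr c" for x :: 'a
    using assms by (intro powr_mono2') auto
  thus "AE x in lborel. norm (indicator (ball (0::'a) \<rho>) x * (x \<bullet> x + e) powr c) \<le> norm (e powr c * indicator (ball (0::'a) \<rho>) x)"
    by (auto simp: indicator_def)
qed (intro borel_measurable_times borel_measurable_indicator powr_real_measurable borel_measurable_add borel_measurable_inner, simp_all)

text \<open>The step function \<open>S K\<close> stacks \<open>K\<close> dyadic balls, weighted so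
  that all contribute the same amount; its integral therefore grows linearly in \<open>K\<close>.
  Pointwise it is at most (2^K)^d and, off the origin, at most (2 \<rho> / |x|)^d, hence at most a
  constant times (|x|^2 + a^2)^(-d/2) with a = \<rho> / 2^K. The witness for \<epsilon> is
  a^2.\<close>

lemma integral_regularized_norm_power_unbounded:
  assumes "\<rho> > 0"
  obtains \<epsilon> where "0 < \<epsilon>" "\<epsilon> \<le> 1"
    "M < (\<integral>x. indicator (ball (0::'a::euclidean_space) \<rho>) x * (x \<bullet> x + \<epsilon>) powr (- real DIM('a) / 2) \<partial>lborel)"
proof -
  let ?d = "DIM('a)"
  let ?v = "unit_ball_vol (real ?d)"
  define S where "S K x = (\<Sum>j<K. (2 ^ j) ^ ?d * indicator (ball (0::'a) ((1/2) ^ j * \<rho>)) x :: real)" for K x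
  \<comment> \<open>The factor (2 \<rho>)^d comes from the pointwise bounds on \<open>S\<close>; the
    factor 2^(d/2) pays for \<open>x \<bullet> x + a\<^sup>2 \<le> 2 * m\<^sup>2\<close>, where
    \<open>m = max (norm x) a\<close>.\<close>
  define c where "c = 2 powr (real ?d / 2) * (2 * \<rho>) ^ ?d"
  have c: "c > 0" using assms by (simp add: c_def)
  have geo: "(\<Sum>j<K. (2 ^ j) ^ ?d :: real) \<le> (2 ^ K) ^ ?d" for K
  proof (induction K)
    case (Suc K)
    have "(2::real) \<le> 2 ^ ?d" using power_increasing[of 1 ?d "2::real"] by (simp add: Suc_leI)
    hence "(2 ^ K) ^ ?d * 2 \<le> (2 ^ K) ^ ?d * (2::real) ^ ?d" by (intro mult_left_mono) auto
    moreover have "(2 ^ Suc K) ^ ?d = (2 ^ K) ^ ?d * (2::real) ^ ?d" by (simp add: power_mult_distrib mult.commute)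
    ultimately show ?case using Suc unfolding sum.lessThan_Suc by linarith
  qed auto
  have S1: "S K x \<le> (2 ^ K) ^ ?d" for K x
  proof -
    have "S K x \<le> (\<Sum>j<K. (2 ^ j) ^ ?d :: real)" unfolding S_def
      by (intro sum_mono) (auto simp: indicator_def)
    thus ?thesis using geo[of K] by simp
  qed
  have S2: "S K x \<le> (2 * \<rho> / norm x) ^ ?d" if "x \<noteq> 0" for K x
  proof (induction K)
    case 0 thus ?case using assms by (simp add: S_def)
  next
    case (Suc K)
    show ?case
    proof (cases "norm x < (1/2) ^ K * \<rho>")
      case True
      have "S (Suc K) x \<le> (2 ^ Suc K) ^ ?d" by (rule S1)
      also have "\<dots> \<le> (2 * \<rho> / norm x) ^ ?d" using True that
        by (intro power_mono) (auto simp: field_simps)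
      finally show ?thesis .
    next
      case False thus ?thesis using Suc by (simp add: S_def)
    qed
  qed
  have Sint: "integrable lborel (S K)" for K unfolding S_def
    by (intro Bochner_Integration.integrable_sum integrable_mult_right integrable_real_indicator) (auto intro: emeasure_bounded_finite simp flip: infinity_ennreal_def)
  have Sval: "integral\<^sup>L lborel (S K) = real K * (?v * \<rho> ^ ?d)" for K
  proof -
    have 1: "integrable lborel (indicator (ball (0::'a) ((1/2) ^ j * \<rho>)) :: 'a \<Rightarrow> real)" for j
      by (intro integrable_real_indicator) (auto intro: emeasure_bounded_finite simp flip: infinity_ennreal_def)
    have 2: "(2 ^ j) ^ ?d * measure lborel (ball (0::'a) ((1/2) ^ j * \<rho>)) = ?v * \<rho> ^ ?d" for j
    proof -
      have "measure lborel (ball (0::'a) ((1/2) ^ j * \<rho>)) = ?v * ((1/2) ^ j * \<rho>) ^ ?d"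
        using assms by (simp add: measure_def emeasure_ball)
      moreover have "(2 ^ j) ^ ?d * ((1/2) ^ j * \<rho>) ^ ?d = \<rho> ^ ?d"
        unfolding power_mult_distrib[symmetric] by (simp add: power_divide)
      ultimately show ?thesis by (simp add: mult.left_commute)
    qed
    have "integral\<^sup>L lborel (S K) = (\<Sum>j<K. \<integral>x. (2 ^ j) ^ ?d * indicator (ball (0::'a) ((1/2) ^ j * \<rho>)) x \<partial>lborel)"
      unfolding S_def by (intro Bochner_Integration.integral_sum integrable_mult_right 1)
    also have "\<dots> = (\<Sum>j<K. ?v * \<rho> ^ ?d)"
      by (intro sum.cong refl) (subst Bochner_Integration.integral_mult_right, rule 1, use 2 in simp)
    finally show ?thesis by simp
  qed
  have vpos: "?v * \<rho> ^ ?d > 0" using assms by simp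
  \<comment> \<open>\<open>K1\<close> makes the integral of \<open>S K\<close> exceed
    \<open>\<bar>M\<bar> * c\<close>; \<open>K2\<close> makes \<open>a \<le> 1\<close>, so that
    \<epsilon> is at most 1.\<close>
  obtain K1 where K1: "\<bar>M\<bar> * c / (?v * \<rho> ^ ?d) < real K1" using reals_Archimedean2 by blast
  obtain K2 where K2: "\<rho> < 2 ^ K2" using real_arch_pow[of 2 \<rho>] by auto
  define K where "K = max K1 K2"
  have K: "\<bar>M\<bar> * c / (?v * \<rho> ^ ?d) < real K" using K1 by (auto simp: K_def)
  have "(2::real) ^ K2 \<le> 2 ^ K" by (intro power_increasing) (auto simp: K_def)
  hence K': "\<rho> \<le> 2 ^ K" using K2 by linarith
  define a where "a = \<rho> / 2 ^ K"
  have a: "0 < a" "a \<le> 1" using assms K' by (auto simp: a_def)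
  have le: "S K x \<le> c * (indicator (ball (0::'a) \<rho>) x * (x \<bullet> x + a\<^sup>2) powr (- real ?d / 2))" for x
  proof (cases "norm x < \<rho>")
    case False
    have "\<not> norm x < (1/2) ^ j * \<rho>" for j
    proof -
      have "(1/2) ^ j * \<rho> \<le> 1 * \<rho>" using assms by (intro mult_right_mono) (auto intro: power_le_one)
      thus ?thesis using False by simp
    qed
    hence "S K x = 0" by (simp add: S_def)
    thus ?thesis using False by simp
  next
    case True
    define m where "m = max (norm x) a"
    have m: "m > 0" "norm x \<le> m" "a \<le> m" using a by (auto simp: m_def)
    have "S K x \<le> (2 * \<rho> / m) ^ ?d"
    proof (cases "norm x \<le> a")
      case True
      have "S K x \<le> (2 ^ K) ^ ?d" by (rule S1)
      also have "\<dots> \<le> (2 * \<rho> / m) ^ ?d" using True assms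
        by (intro power_mono) (auto simp: m_def a_def max_def)
      finally show ?thesis .
    next
      case False
      hence "x \<noteq> 0" using a by auto
      thus ?thesis using S2[of x K] False by (simp add: m_def max_def)
    qed
    also have "\<dots> = c * (2 * m\<^sup>2) powr (- real ?d / 2)"
    proof -
      have "(m\<^sup>2) powr (- real ?d / 2) = m powr - real ?d"
        using m by (simp flip: powr_numeral add: powr_powr)
      thus ?thesis using m unfolding c_def powr_mult
        by (simp add: powr_minus powr_realpow power_mult_distrib power_divide field_simps)
    qed
    also have "\<dots> \<le> c * (x \<bullet> x + a\<^sup>2) powr (- real ?d / 2)"
    proof (intro mult_left_mono powr_mono2')
      have "(norm x)\<^sup>2 \<le> m\<^sup>2" "a\<^sup>2 \<le> m\<^sup>2" using m a by (auto intro: power_mono)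
      thus "x \<bullet> x + a\<^sup>2 \<le> 2 * m\<^sup>2" by (simp add: power2_norm_eq_inner)
      show "0 < x \<bullet> x + a\<^sup>2" using a by (simp add: add_nonneg_pos)
    qed (use c in auto)
    finally show ?thesis using True by simp
  qed
  have iint: "integrable lborel (\<lambda>x. indicator (ball (0::'a) \<rho>) x * (x \<bullet> x + a\<^sup>2) powr (- real ?d / 2))"
    using a by (intro integrable_regularized_norm_power) auto
  have "\<bar>M\<bar> * c < real K * (?v * \<rho> ^ ?d)" using K vpos by (simp add: field_simps)
  also have "\<dots> \<le> integral\<^sup>L lborel (\<lambda>x. c * (indicator (ball (0::'a) \<rho>) x * (x \<bullet> x + a\<^sup>2) powr (- real ?d / 2)))"
    unfolding Sval[symmetric] using iint le by (intro integral_mono Sint) auto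
  also have "\<dots> = integral\<^sup>L lborel (\<lambda>x. indicator (ball (0::'a) \<rho>) x * (x \<bullet> x + a\<^sup>2) powr (- real ?d / 2)) * c"
    by simp
  finally have "\<bar>M\<bar> < integral\<^sup>L lborel (\<lambda>x. indicator (ball (0::'a) \<rho>) x * (x \<bullet> x + a\<^sup>2) powr (- real ?d / 2))"
    using c by simp
  thus ?thesis using that[of "a\<^sup>2"] a by (auto simp: power_le_one)
qed

section \<open>Test functions and radial vector fields\<close>

lemma partial_deriv_eq:
  assumes "((\<lambda>t. f (x + t *\<^sub>R axis i 1)) has_real_derivative d) (at 0)"
  shows "partial_deriv i f x = d"
  unfolding partial_deriv_def using assms by (rule DERIV_imp_deriv)

lemma has_partial_deriv:
  assumes "f differentiable (at x)"
  shows "((\<lambda>t. f (x + t *\<^sub>R axis i 1)) has_real_derivative partial_deriv i f x) (at 0)"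
proof -
  obtain D where D: "(f has_derivative D) (at x)" using assms by (auto simp: differentiable_def)
  have "((\<lambda>t. x + t *\<^sub>R axis i 1) has_derivative (\<lambda>t. t *\<^sub>R axis i 1)) (at 0)"
    by (auto intro!: derivative_eq_intros)
  hence "((f \<circ> (\<lambda>t. x + t *\<^sub>R axis i 1)) has_derivative (D \<circ> (\<lambda>t. t *\<^sub>R axis i 1))) (at 0)"
    using D by (intro diff_chain_at) auto
  moreover have "D \<circ> (\<lambda>t. t *\<^sub>R axis i 1) = (*) (D (axis i 1))"
    using linear_cmul[OF has_derivative_linear[OF D]] by (auto simp: fun_eq_iff)
  ultimately have "((\<lambda>t. f (x + t *\<^sub>R axis i 1)) has_real_derivative D (axis i 1)) (at 0)"
    by (simp add: has_field_derivative_def o_def)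
  thus ?thesis using partial_deriv_eq by metis
qed

lemma DERIV_line_outside:
  fixes x v :: "'a::real_normed_vector" and f :: "'a \<Rightarrow> real"
  assumes "\<And>x. norm x > r \<Longrightarrow> f x = 0" "norm x > r"
  shows "((\<lambda>t. f (x + t *\<^sub>R v)) has_real_derivative 0) (at 0)"
proof -
  have "open {t. r < norm (x + t *\<^sub>R v)}"
    by (intro open_Collect_less continuous_intros)
  hence "eventually (\<lambda>t. t \<in> {t. r < norm (x + t *\<^sub>R v)}) (nhds 0)"
    by (rule eventually_nhds_in_open) (use assms(2) in auto)
  hence "eventually (\<lambda>t. f (x + t *\<^sub>R v) = 0) (nhds 0)"
    by eventually_elim (use assms(1) in auto)
  thus ?thesis
    by (subst DERIV_cong_ev[where g = "\<lambda>_. 0"]) auto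
qed

lemma partial_deriv_eq_0_outside:
  assumes "\<And>x. norm x > r \<Longrightarrow> f x = 0" "norm x > r"
  shows "partial_deriv i f x = 0"
  by (rule partial_deriv_eq[OF DERIV_line_outside[OF assms]])

lemma smooth_on_partial_deriv: "smooth_on S f \<Longrightarrow> smooth_on S (partial_deriv i f)"
  unfolding smooth_on_def using Ck_on.simps(2) by blast

text \<open>Smoothness is given on the open unit ball only. A point outside it lies in the open set
  where the norm exceeds \<open>r\<close>, and there the function is identically zero.\<close>

lemma smooth_on_ball_differentiable:
  assumes "smooth_on (ball 0 1) f" "r < 1" "\<And>x. norm x > r \<Longrightarrow> f x = 0"
  shows "f differentiable (at x)"
proof (cases "norm x < 1")
  case True
  have "Ck_on (Suc 0) (ball 0 1) f" using assms(1) unfolding smooth_on_def by blast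
  thus ?thesis using True by auto
next
  case False
  have o: "open {y. r < norm y}" by (intro open_Collect_less continuous_intros)
  have "((\<lambda>_. 0) has_derivative (\<lambda>_. 0)) (at x)" by simp
  hence "(f has_derivative (\<lambda>_. 0)) (at x)"
    by (rule has_derivative_transform_within_open[OF _ o]) (use False assms in auto)
  thus ?thesis by (auto simp: differentiable_def)
qed

text \<open>The radius is kept explicit, so that the class is visibly closed under partial derivatives.\<close>

definition test_fun :: "real \<Rightarrow> (real^'n::finite \<Rightarrow> real) \<Rightarrow> bool" where
  "test_fun r f \<longleftrightarrow> smooth_on (ball 0 1) f \<and> (\<forall>x. norm x > r \<longrightarrow> f x = 0)"

lemma test_fun_partial_deriv: "test_fun r f \<Longrightarrow> test_fun r (partial_deriv i f)"
  unfolding test_fun_def using smooth_on_partial_deriv partial_deriv_eq_0_outside by metis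

lemma test_fun_zero: "test_fun r f \<Longrightarrow> norm x > r \<Longrightarrow> f x = 0"
  unfolding test_fun_def by blast

lemma test_fun_differentiable: "test_fun r f \<Longrightarrow> r < 1 \<Longrightarrow> f differentiable (at x)"
  unfolding test_fun_def using smooth_on_ball_differentiable by blast

lemma test_fun_continuous: "test_fun r f \<Longrightarrow> r < 1 \<Longrightarrow> continuous_on UNIV f"
  using test_fun_differentiable differentiable_imp_continuous_within
  by (metis continuous_at_imp_continuous_on)

lemma test_fun_deriv:
  "test_fun r f \<Longrightarrow> r < 1 \<Longrightarrow>
    ((\<lambda>t. f (x + t *\<^sub>R axis i 1)) has_real_derivative partial_deriv i f x) (at 0)"
  by (intro has_partial_deriv test_fun_differentiable)

text \<open>The norm attains its maximum on the compact support, and this maximum is below 1. Taking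
  the larger of it and 1/2 keeps \<open>r\<close> positive, also for empty support.\<close>

lemma hyp_test_function_test_fun:
  assumes "u \<in> hyp_test_functions"
  obtains r where "0 < r" "r < 1" "test_fun r u"
proof -
  let ?S = "closure {x. u x \<noteq> 0}"
  have S: "compact ?S" "?S \<subseteq> ball 0 1" and sm: "smooth_on (ball 0 1) u"
    using assms by (auto simp: hyp_test_functions_def)
  have "\<exists>r<1. \<forall>x\<in>?S. norm x \<le> r"
  proof (cases "?S = {}")
    case True thus ?thesis by (intro exI[of _ 0]) auto
  next
    case False
    obtain y where y: "y \<in> ?S" "\<forall>x\<in>?S. norm x \<le> norm y"
      using continuous_attains_sup[OF S(1) False, of norm] by (auto intro: continuous_intros)
    thus ?thesis using S(2) by (intro exI[of _ "norm y"]) auto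
  qed
  then obtain r where r: "r < 1" "\<forall>x\<in>?S. norm x \<le> r" by blast
  have "u x = 0" if "norm x > max r (1/2)" for x
    using r(2) closure_subset[of "{x. u x \<noteq> 0}"] that by (metis (mono_tags, lifting) max_less_iff_conj mem_Collect_eq not_le subsetD)
  thus ?thesis using r sm by (intro that[of "max r (1/2)"]) (auto simp: test_fun_def)
qed

section \<open>Functions of the squared norm and the divergence theorem\<close>

lemma DERIV_norm_square_line:
  "((\<lambda>t. (x + t *\<^sub>R axis i 1) \<bullet> (x + t *\<^sub>R axis i 1)) has_real_derivative 2 * x $ i) (at (0::real))"
  for x :: "real^'n::finite"
proof -
  have "(\<lambda>t. (x + t *\<^sub>R axis i 1) \<bullet> (x + t *\<^sub>R axis i 1)) = (\<lambda>t. x \<bullet> x + 2 * t * (x $ i) + t * t)"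
    by (auto simp: fun_eq_iff inner_add inner_axis inner_axis' inner_commute algebra_simps)
  thus ?thesis by (auto intro!: derivative_eq_intros)
qed

lemma DERIV_comp_norm_square_line:
  fixes x :: "real^'n::finite"
  assumes "(h has_real_derivative d) (at (x \<bullet> x))"
  shows "((\<lambda>t. h ((x + t *\<^sub>R axis i 1) \<bullet> (x + t *\<^sub>R axis i 1))) has_real_derivative d * (2 * x $ i)) (at (0::real))"
  using DERIV_chain2[OF _ DERIV_norm_square_line[of x i], of h d] assms by simp

lemma DERIV_component_line:
  "((\<lambda>t. (x + t *\<^sub>R axis i 1) $ i) has_real_derivative 1) (at (0::real))"
  for x :: "real^'n::finite"
  by (auto intro!: derivative_eq_intros simp: axis_def)

lemma sum_partials:
  fixes x :: "real^'n::finite"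
  shows "(\<Sum>i\<in>UNIV. x $ i * x $ i) = x \<bullet> x"
    and "(\<Sum>i\<in>UNIV. x $ i * partial_deriv i f x) = x \<bullet> gradient f x"
    and "(\<Sum>i\<in>UNIV. partial_deriv i f x * partial_deriv i f x) = gradient f x \<bullet> gradient f x"
  by (simp_all add: inner_vec_def gradient_def)

lemma inner_lt_1_iff: "x \<bullet> x < 1 \<longleftrightarrow> norm x < 1" for x :: "'a::real_inner"
  by (simp add: norm_eq_sqrt_inner)

text \<open>The divergence of the vector field \<open>A(|x|\<^sup>2) u \<nabla>u + B(|x|\<^sup>2) u\<^sup>2 x\<close>.\<close>

definition radial_div ::
  "real \<Rightarrow> real \<Rightarrow> real \<Rightarrow> real \<Rightarrow> (real^'n::finite \<Rightarrow> real) \<Rightarrow> real^'n \<Rightarrow> real" where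
  "radial_div A A' B B' u x =
     2 * A' * u x * (x \<bullet> gradient u x) + A * (gradient u x \<bullet> gradient u x) + A * u x * laplacian u x
     + (2 * (x \<bullet> x) * B' + real CARD('n) * B) * (u x)\<^sup>2 + 2 * B * u x * (x \<bullet> gradient u x)"

text \<open>The factor \<open>h\<close> may blow up at 1, as powers of the conformal factor do. The
  unit ball and the complement of the closed ball of radius \<open>r < 1\<close> form an open cover
  of the space; on the second set the product is zero.\<close>

lemma continuous_on_comp_norm_square_mult:
  fixes f :: "real^'n::finite \<Rightarrow> real"
  assumes h: "continuous_on {0..<1} h" and f: "continuous_on UNIV f"
    and r: "r < 1" "\<And>x. norm x > r \<Longrightarrow> f x = 0"
  shows "continuous_on UNIV (\<lambda>x. h (x \<bullet> x) * f x)"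
proof -
  have "continuous_on (ball 0 1 \<union> - cball 0 r) (\<lambda>x. h (x \<bullet> x) * f x)"
  proof (rule continuous_on_open_Un)
    show "continuous_on (ball 0 1) (\<lambda>x. h (x \<bullet> x) * f x)"
      by (intro continuous_on_mult continuous_on_compose2[OF h] continuous_on_subset[OF f] continuous_intros)
        (auto simp: inner_lt_1_iff)
    have "continuous_on (- cball 0 r) (\<lambda>x::real^'n. 0::real)" by simp
    thus "continuous_on (- cball 0 r) (\<lambda>x. h (x \<bullet> x) * f x)"
      by (rule continuous_on_eq) (use r in auto)
  qed auto
  moreover have "ball 0 1 \<union> - cball 0 r = (UNIV :: (real^'n) set)" using r by auto
  ultimately show ?thesis by simp
qed

lemma test_fun_continuous_all:
  assumes "test_fun r u" "r < 1"
  shows "continuous_on UNIV u" "continuous_on UNIV (partial_deriv i u)"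
    "continuous_on UNIV (gradient u)" "continuous_on UNIV (laplacian u)"
proof -
  note tf = assms(1) test_fun_partial_deriv[OF assms(1)] test_fun_partial_deriv[OF test_fun_partial_deriv[OF assms(1)]]
  note c = tf[THEN test_fun_continuous[OF _ assms(2)]]
  show "continuous_on UNIV u" "continuous_on UNIV (partial_deriv i u)" by (rule c)+
  show "continuous_on UNIV (gradient u)" unfolding gradient_def by (intro continuous_on_vec_lambda c)
  show "continuous_on UNIV (laplacian u)" unfolding laplacian_def by (intro continuous_on_sum c)
qed

lemma test_fun_laplacian_zero:
  assumes "test_fun r u" "norm x > r"
  shows "gradient u x = 0" "laplacian u x = 0"
  using assms test_fun_zero[OF test_fun_partial_deriv[OF assms(1)], of x] test_fun_zero[OF test_fun_partial_deriv[OF test_fun_partial_deriv[OF assms(1)]], of x]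
  by (simp_all add: gradient_def laplacian_def vec_eq_iff)

text \<open>The summand for \<open>i\<close> is the product-rule expansion of the partial derivative
  in direction \<open>i\<close> of the component \<open>i\<close> of the vector field.\<close>

lemma radial_div_eq_sum:
  "radial_div a a' b b' u x = (\<Sum>i\<in>UNIV. a' * (2 * x $ i * u x * partial_deriv i u x)
    + a * (partial_deriv i u x * partial_deriv i u x + u x * partial_deriv i (partial_deriv i u) x)
    + b' * (2 * (x $ i * x $ i) * (u x)\<^sup>2) + b * (2 * u x * partial_deriv i u x * x $ i + (u x)\<^sup>2))"
  unfolding radial_div_def laplacian_def sum_partials(1)[of x, symmetric] sum_partials(2,3)[symmetric]
  by (simp add: sum.distrib sum_distrib_left sum_distrib_right algebra_simps)

text \<open>The divergence theorem without boundary term: \<open>f i\<close> is a component of the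
  vector field and \<open>g i\<close> its derivative in the same direction. Both are continuous with
  compact support, so each \<open>g i\<close> integrates to zero. Differentiability of
  \<open>A\<close> and \<open>B\<close> on [0,1) suffices because \<open>u\<close> vanishes near the
  unit sphere.\<close>

lemma integral_radial_div:
  fixes u :: "real^'n::finite \<Rightarrow> real"
  assumes u: "test_fun r u" and r: "r < 1"
    and A: "\<And>t. 0 \<le> t \<Longrightarrow> t < 1 \<Longrightarrow> (A has_real_derivative A' t) (at t)"
    and B: "\<And>t. 0 \<le> t \<Longrightarrow> t < 1 \<Longrightarrow> (B has_real_derivative B' t) (at t)"
    and A': "continuous_on {0..<1} A'" and B': "continuous_on {0..<1} B'"
  shows "(\<integral>x. radial_div (A (x \<bullet> x)) (A' (x \<bullet> x)) (B (x \<bullet> x)) (B' (x \<bullet> x)) u x \<partial>lborel) = 0"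
proof -
  let ?p = "\<lambda>i. partial_deriv i u"
  let ?N = "\<lambda>x::real^'n. x \<bullet> x"
  define f where "f i x = A (?N x) * (u x * ?p i x) + B (?N x) * ((u x)\<^sup>2 * x $ i)" for i x
  define g where "g i x = A' (?N x) * (2 * x $ i * u x * ?p i x)
    + A (?N x) * (?p i x * ?p i x + u x * partial_deriv i (?p i) x)
    + B' (?N x) * (2 * (x $ i * x $ i) * (u x)\<^sup>2) + B (?N x) * (2 * u x * ?p i x * x $ i + (u x)\<^sup>2)" for i x
  note u0 = test_fun_zero[OF u]
  note u1 = test_fun_zero[OF test_fun_partial_deriv[OF u]]
  note d0 = test_fun_deriv[OF u r] and d1 = test_fun_deriv[OF test_fun_partial_deriv[OF u] r]
  note c0 = test_fun_continuous[OF u r] and c1 = test_fun_continuous[OF test_fun_partial_deriv[OF u] r]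
    and c2 = test_fun_continuous[OF test_fun_partial_deriv[OF test_fun_partial_deriv[OF u]] r]
  have cA: "continuous_on {0..<1} A" "continuous_on {0..<1} B"
    by (rule DERIV_continuous_on, rule has_field_derivative_at_within, rule A, simp, simp)
      (rule DERIV_continuous_on, rule has_field_derivative_at_within, rule B, simp, simp)
  have cf: "continuous_on UNIV (f i)" for i unfolding f_def
    by (intro continuous_on_add continuous_on_comp_norm_square_mult[OF _ _ r] cA)
      (auto intro!: continuous_intros c0 c1 simp: u0)
  have cg: "continuous_on UNIV (g i)" for i unfolding g_def
    by (intro continuous_on_add continuous_on_comp_norm_square_mult[OF _ _ r] cA A' B')
      (auto intro!: continuous_intros c0 c1 c2 simp: u0 u1)
  have f0: "f i x = 0" and g0: "g i x = 0" if "norm x > r" for i x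
    using u0 u1 that by (auto simp: f_def g_def)
  have der: "((\<lambda>t. f i (x + t *\<^sub>R axis i 1)) has_real_derivative g i x) (at 0)" for i x
  proof (cases "norm x < 1")
    case False
    thus ?thesis using DERIV_line_outside[of r "f i" x "axis i 1"] f0 g0[of x i] r by simp
  next
    case True
    hence x: "0 \<le> ?N x" "?N x < 1" by (simp_all add: inner_lt_1_iff)
    show ?thesis unfolding f_def g_def
      by (rule derivative_eq_intros d0 d1 DERIV_comp_norm_square_line DERIV_component_line A B x refl)+
        (simp add: algebra_simps power2_eq_square)
  qed
  have int0: "integral\<^sup>L lborel (g i) = 0" for i
    by (rule integral_directional_derivative_eq_0[OF der cf cg f0 g0])
  have "radial_div (A (?N x)) (A' (?N x)) (B (?N x)) (B' (?N x)) u x = (\<Sum>i\<in>UNIV. g i x)" for x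
    unfolding radial_div_eq_sum g_def ..
  hence "(\<integral>x. radial_div (A (?N x)) (A' (?N x)) (B (?N x)) (B' (?N x)) u x \<partial>lborel)
    = (\<Sum>i\<in>UNIV. integral\<^sup>L lborel (g i))"
    by (simp only:) (intro Bochner_Integration.integral_sum integrable_compact_support[OF cg g0])
  thus ?thesis by (simp add: int0)
qed

lemma bounded_comp_norm_square_mult:
  fixes f :: "real^'n::finite \<Rightarrow> real"
  assumes h: "continuous_on {0..<1} h" and f: "continuous_on UNIV f"
    and r: "r < 1" "\<And>x. norm x > r \<Longrightarrow> f x = 0"
  obtains M where "M \<ge> 0" "\<And>x. \<bar>h (x \<bullet> x) * f x\<bar> \<le> M"
  using bounded_compact_support[OF continuous_on_comp_norm_square_mult[OF assms], of r] r by auto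

text \<open>The singularities of \<open>A/t\<close> and \<open>B/t\<^sup>2\<close> at the origin are removed by the factor \<open>t\<^sup>2/(t + \<epsilon>)\<^sup>2\<close>;
  all error terms are dominated by a multiple of \<open>|x|\<^sup>-\<^sup>4\<close>.\<close>

lemma integral_radial_div_singular:
  fixes u :: "real^'n::finite \<Rightarrow> real"
  assumes n: "CARD('n) \<ge> 5"
    and u: "test_fun r u" and r: "r < 1"
    and A: "\<And>t. 0 \<le> t \<Longrightarrow> t < 1 \<Longrightarrow> (A has_real_derivative A' t) (at t)"
    and B: "\<And>t. 0 \<le> t \<Longrightarrow> t < 1 \<Longrightarrow> (B has_real_derivative B' t) (at t)"
    and A': "continuous_on {0..<1} A'" and B': "continuous_on {0..<1} B'"
  defines "G \<equiv> \<lambda>x. radial_div (A (x \<bullet> x) / (x \<bullet> x)) (A' (x \<bullet> x) / (x \<bullet> x) - A (x \<bullet> x) / (x \<bullet> x)\<^sup>2)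
      (B (x \<bullet> x) / (x \<bullet> x)\<^sup>2) (B' (x \<bullet> x) / (x \<bullet> x)\<^sup>2 - 2 * B (x \<bullet> x) / (x \<bullet> x) ^ 3) u x"
  shows "integrable lborel G" "integral\<^sup>L lborel G = 0"
proof -
  let ?N = "\<lambda>x::real^'n. x \<bullet> x"
  let ?D = "\<lambda>x. x \<bullet> gradient u x"
  define e where "e k = 1 / real (Suc k)" for k
  have e: "e k > 0" for k by (simp add: e_def)
  have e0: "e \<longlonglongrightarrow> 0" using LIMSEQ_inverse_real_of_nat unfolding e_def by (simp add: inverse_eq_divide)
  \<comment> \<open>The divergence is sorted by the way its terms are regularized: \<open>G1\<close>
    to \<open>G4\<close> are continuous with compact support, and all dependence on \<epsilon> sits
    in \<open>c1\<close> to \<open>c4\<close>. At \<epsilon> = 0 these four become 1/N, -1/N^2,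
    1/N^2 and 1/N^2, which reproduces \<open>G\<close>.\<close>
  define G1 where "G1 x = A' (?N x) * (2 * u x * ?D x) + A (?N x) * (gradient u x \<bullet> gradient u x + u x * laplacian u x)" for x
  define G2 where "G2 x = A (?N x) * (2 * u x * ?D x)" for x
  define G3 where "G3 x = B' (?N x) * (2 * ?N x * (u x)\<^sup>2) + B (?N x) * (real CARD('n) * (u x)\<^sup>2 + 2 * u x * ?D x)" for x
  define G4 where "G4 x = B (?N x) * (4 * (u x)\<^sup>2)" for x
  define c1 where "c1 N e = N / (N + e)\<^sup>2" for N e :: real
  define c2 where "c2 N e = 1 / (N + e)\<^sup>2 - 2 * N / (N + e) ^ 3" for N e :: real
  define c3 where "c3 N e = 1 / (N + e)\<^sup>2" for N e :: real
  define c4 where "c4 N e = N / (N + e) ^ 3" for N e :: real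
  define s where "s k x = c1 (?N x) (e k) * G1 x + c2 (?N x) (e k) * G2 x + c3 (?N x) (e k) * G3 x - c4 (?N x) (e k) * G4 x" for k x
  note cont = test_fun_continuous_all[OF u r]
  note zero = test_fun_zero[OF u] test_fun_laplacian_zero[OF u]
  have cA: "continuous_on {0..<1} A" "continuous_on {0..<1} B"
    by (rule DERIV_continuous_on, rule has_field_derivative_at_within, rule A, simp, simp)
      (rule DERIV_continuous_on, rule has_field_derivative_at_within, rule B, simp, simp)
  have cG: "continuous_on UNIV G1" "continuous_on UNIV G2" "continuous_on UNIV G3" "continuous_on UNIV G4"
    unfolding G1_def G2_def G3_def G4_def
    by (intro continuous_on_add continuous_on_comp_norm_square_mult[OF _ _ r] cA A' B';
        (intro continuous_intros cont)?; simp add: zero)+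
  have zG: "G1 x = 0" "G2 x = 0" "G3 x = 0" "G4 x = 0" if "norm x > r" for x
    using zero[OF that] by (auto simp: G1_def G2_def G3_def G4_def)
  obtain M1 where M1: "M1 \<ge> 0" "\<And>x. \<bar>G1 x\<bar> \<le> M1" using bounded_compact_support[OF cG(1) zG(1)] by blast
  obtain M2 where M2: "M2 \<ge> 0" "\<And>x. \<bar>G2 x\<bar> \<le> M2" using bounded_compact_support[OF cG(2) zG(2)] by blast
  obtain M3 where M3: "M3 \<ge> 0" "\<And>x. \<bar>G3 x\<bar> \<le> M3" using bounded_compact_support[OF cG(3) zG(3)] by blast
  obtain M4 where M4: "M4 \<ge> 0" "\<And>x. \<bar>G4 x\<bar> \<le> M4" using bounded_compact_support[OF cG(4) zG(4)] by blast
  define M where "M = M1 + 3 * M2 + M3 + M4"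
  have c_bound: "\<bar>c1 N d\<bar> \<le> 1 / N\<^sup>2" "\<bar>c2 N d\<bar> \<le> 3 / N\<^sup>2" "\<bar>c3 N d\<bar> \<le> 1 / N\<^sup>2" "\<bar>c4 N d\<bar> \<le> 1 / N\<^sup>2"
    if "0 < N" "N < 1" "0 < d" for N d
  proof -
    have 3: "1 / (N + d)\<^sup>2 \<le> 1 / N\<^sup>2" using that by (intro divide_left_mono power_mono) auto
    have "N / (N + d) ^ 3 = 1 / (N + d)\<^sup>2 * (N / (N + d))" using that by (simp add: power2_eq_square power3_eq_cube field_simps)
    also have "\<dots> \<le> 1 / N\<^sup>2 * 1" using 3 that by (intro mult_mono) auto
    finally have 4: "N / (N + d) ^ 3 \<le> 1 / N\<^sup>2" by simp
    have "N / (N + d)\<^sup>2 = N * (1 / (N + d)\<^sup>2)" by simp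
    also have "\<dots> \<le> 1 * (1 / N\<^sup>2)" using 3 that by (intro mult_mono) auto
    finally have 1: "N / (N + d)\<^sup>2 \<le> 1 / N\<^sup>2" by simp
    have p: "0 \<le> N / (N + d) ^ 3" "0 \<le> N / (N + d)\<^sup>2" "0 \<le> 1 / (N + d)\<^sup>2" using that by auto
    show "\<bar>c1 N d\<bar> \<le> 1 / N\<^sup>2" "\<bar>c3 N d\<bar> \<le> 1 / N\<^sup>2" "\<bar>c4 N d\<bar> \<le> 1 / N\<^sup>2"
      using 1 3 4 p unfolding c1_def c3_def c4_def by auto
    have "\<bar>c2 N d\<bar> \<le> 1 / (N + d)\<^sup>2 + 2 * (N / (N + d) ^ 3)" using p unfolding c2_def by (simp add: abs_if)
    also have "\<dots> \<le> 1 / N\<^sup>2 + 2 * (1 / N\<^sup>2)" using 3 4 by linarith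
    finally show "\<bar>c2 N d\<bar> \<le> 3 / N\<^sup>2" by simp
  qed
  have s_bound: "\<bar>s k x\<bar> \<le> M * (indicator (ball 0 1) x / (?N x)\<^sup>2)" if "x \<noteq> 0" for k x
  proof (cases "norm x < 1")
    case False
    hence "s k x = 0" using zG[of x] r by (simp add: s_def)
    thus ?thesis using False by simp
  next
    case True
    hence x: "0 < ?N x" "?N x < 1" using that by (simp_all add: inner_lt_1_iff)
    note c = c_bound[OF x e[of k]]
    have "\<bar>s k x\<bar> \<le> \<bar>c1 (?N x) (e k)\<bar> * \<bar>G1 x\<bar> + \<bar>c2 (?N x) (e k)\<bar> * \<bar>G2 x\<bar> + \<bar>c3 (?N x) (e k)\<bar> * \<bar>G3 x\<bar> + \<bar>c4 (?N x) (e k)\<bar> * \<bar>G4 x\<bar>"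
      unfolding s_def abs_mult[symmetric] by linarith
    also have "\<dots> \<le> 1 / (?N x)\<^sup>2 * M1 + 3 / (?N x)\<^sup>2 * M2 + 1 / (?N x)\<^sup>2 * M3 + 1 / (?N x)\<^sup>2 * M4"
      using M1 M2 M3 M4 c by (intro add_mono mult_mono) auto
    also have "\<dots> = M * (1 / (?N x)\<^sup>2)" by (simp add: M_def add_divide_distrib)
    finally show ?thesis using True by simp
  qed
  have s0: "integral\<^sup>L lborel (s k) = 0" for k
  proof -
    define a where "a t = t * A t / (t + e k)\<^sup>2" for t
    define a' where "a' t = (A t + t * A' t) / (t + e k)\<^sup>2 - 2 * t * A t / (t + e k) ^ 3" for t
    define b where "b t = B t / (t + e k)\<^sup>2" for t
    define b' where "b' t = B' t / (t + e k)\<^sup>2 - 2 * B t / (t + e k) ^ 3" for t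
    have ne: "t + e k \<noteq> 0" if "0 \<le> t" for t using e[of k] that by linarith
    have da: "(a has_real_derivative a' t) (at t)" if "0 \<le> t" "t < 1" for t
      unfolding a_def a'_def using ne[OF that(1)]
      by (auto intro!: derivative_eq_intros A that simp: power2_eq_square power3_eq_cube divide_simps; simp add: algebra_simps)
    have db: "(b has_real_derivative b' t) (at t)" if "0 \<le> t" "t < 1" for t
      unfolding b_def b'_def using ne[OF that(1)]
      by (auto intro!: derivative_eq_intros B that simp: power2_eq_square power3_eq_cube divide_simps; simp add: algebra_simps)
    have "continuous_on {0..<1} a'" "continuous_on {0..<1} b'" unfolding a'_def b'_def
      by (intro continuous_intros cA A' B'; use ne in force)+
    hence "(\<integral>x. radial_div (a (?N x)) (a' (?N x)) (b (?N x)) (b' (?N x)) u x \<partial>lborel) = 0"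
      by (intro integral_radial_div[OF u r] da db)
    moreover have "radial_div (a (?N x)) (a' (?N x)) (b (?N x)) (b' (?N x)) u x = s k x" for x
    proof -
      define N where "N = ?N x"
      have "N + e k \<noteq> 0" by (rule ne) (simp add: N_def)
      thus ?thesis unfolding radial_div_def s_def G1_def G2_def G3_def G4_def a_def a'_def b_def b'_def c1_def c2_def c3_def c4_def
        N_def[symmetric]
        by (simp add: divide_simps power2_eq_square power3_eq_cube) (simp add: algebra_simps)
    qed
    ultimately show ?thesis by simp
  qed
  have lim: "(\<lambda>k. s k x) \<longlonglongrightarrow> G x" if "x \<noteq> 0" for x
  proof -
    have N: "?N x \<noteq> 0" using that by simp
    have "(\<lambda>k. s k x) \<longlonglongrightarrow> c1 (?N x) 0 * G1 x + c2 (?N x) 0 * G2 x + c3 (?N x) 0 * G3 x - c4 (?N x) 0 * G4 x"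
      unfolding s_def c1_def c2_def c3_def c4_def
      by (intro tendsto_intros e0) (use N in auto)
    also have "c1 (?N x) 0 * G1 x + c2 (?N x) 0 * G2 x + c3 (?N x) 0 * G3 x - c4 (?N x) 0 * G4 x = G x"
    proof -
      define N where "N = ?N x"
      have "N \<noteq> 0" using N by (simp add: N_def)
      thus ?thesis unfolding radial_div_def G_def G1_def G2_def G3_def G4_def c1_def c2_def c3_def c4_def N_def[symmetric]
        by (simp add: divide_simps power2_eq_square power3_eq_cube) (simp add: algebra_simps)
    qed
    finally show ?thesis .
  qed
  have ms: "s k \<in> borel_measurable lborel" for k
    unfolding s_def c1_def c2_def c3_def c4_def using cG[THEN borel_measurable_continuous_onI]
    by (intro borel_measurable_add borel_measurable_diff borel_measurable_times borel_measurable_divide borel_measurable_power borel_measurable_inner) simp_all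
  have AE0: "AE x in lborel. x \<noteq> (0::real^'n)" by (rule AE_lborel_singleton)
  have mG: "G \<in> borel_measurable lborel"
  proof -
    \<comment> \<open>Convergence is established only off the origin, so the value at 0 is
      prescribed separately and \<open>G\<close> is measurable as a pointwise limit
      elsewhere.\<close>
    have "(\<lambda>x. if x = 0 then G 0 else lim (\<lambda>k. s k x)) = G"
      using lim[THEN limI] by (auto simp: fun_eq_iff)
    moreover have "(\<lambda>x. if x = 0 then G 0 else lim (\<lambda>k. s k x)) \<in> borel_measurable lborel"
      using ms by measurable
    ultimately show ?thesis by simp
  qed
  have w: "integrable lborel (\<lambda>x::real^'n. M * (indicator (ball 0 1) x / (?N x)\<^sup>2))"
    by (intro integrable_mult_right integrable_inverse_norm_power4) (use n in simp)
  have l: "AE x in lborel. (\<lambda>k. s k x) \<longlonglongrightarrow> G x" using AE0 by eventually_elim (rule lim)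
  have b: "AE x in lborel. norm (s k x) \<le> M * (indicator (ball 0 1) x / (?N x)\<^sup>2)" for k
    using AE0 by eventually_elim (use s_bound in auto)
  show "integrable lborel G" by (rule integrable_dominated_convergence[OF mG ms w l b])
  have "(\<lambda>k. integral\<^sup>L lborel (s k)) \<longlonglongrightarrow> integral\<^sup>L lborel G"
    by (rule integral_dominated_convergence[OF mG ms w l b])
  thus "integral\<^sup>L lborel G = 0" by (simp add: s0 LIMSEQ_const_iff)
qed

section \<open>Hyperbolic volume\<close>

lemma hyp_vol_density_measurable:
  "(\<lambda>x::real^'n::finite. (2 / (1 - (norm x)\<^sup>2)) ^ CARD('n)) \<in> borel_measurable (restrict_space lborel (ball 0 1))"
  by (rule measurable_restrict_space1) (simp, measurable)

lemma hyp_vol_density_nonneg: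
  "AE x::real^'n::finite in restrict_space lborel (ball 0 1). 0 \<le> (2 / (1 - (norm x)\<^sup>2)) ^ CARD('n)"
  by (intro AE_I2) (auto simp: space_restrict_space power_le_one intro!: zero_le_power divide_nonneg_nonneg)

lemma hyp_vol_integrable_iff:
  fixes f :: "real^'n::finite \<Rightarrow> real"
  assumes "f \<in> borel_measurable (restrict_space lborel (ball 0 1))"
  shows "integrable hyp_vol f \<longleftrightarrow>
    integrable lborel (\<lambda>x. indicator (ball 0 1) x * ((2 / (1 - x \<bullet> x)) ^ CARD('n) * f x))"
  unfolding hyp_vol_def
  by (subst integrable_density[OF assms hyp_vol_density_measurable hyp_vol_density_nonneg], subst integrable_restrict_space)
    (simp_all add: power2_norm_eq_inner)

lemma hyp_vol_integral_eq:
  fixes f :: "real^'n::finite \<Rightarrow> real"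
  assumes "f \<in> borel_measurable (restrict_space lborel (ball 0 1))"
  shows "integral\<^sup>L hyp_vol f =
    (\<integral>x. indicator (ball 0 1) x * ((2 / (1 - x \<bullet> x)) ^ CARD('n) * f x) \<partial>lborel)"
  unfolding hyp_vol_def
  by (subst integral_density[OF assms hyp_vol_density_measurable hyp_vol_density_nonneg], subst integral_restrict_space)
    (simp_all add: power2_norm_eq_inner)

section \<open>Geodesic balls as Euclidean balls, and their volume\<close>

lemma hyp_ball_hyp_rho:
  fixes x :: "real^'n::finite"
  assumes "norm x < 1"
  shows "hyp_ball (hyp_rho x) = (ball 0 (norm x) :: (real^'n) set)"
proof -
  have "hyp_rho y < hyp_rho x \<longleftrightarrow> norm y < norm x" if "norm y < 1" for y :: "real^'n"
  proof -
    have "hyp_rho y < hyp_rho x \<longleftrightarrow> (1 + norm y) / (1 - norm y) < (1 + norm x) / (1 - norm x)"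
      unfolding hyp_rho_def using that assms by (subst ln_less_cancel_iff) (auto simp: add_pos_nonneg)
    also have "\<dots> \<longleftrightarrow> (1 + norm y) * (1 - norm x) < (1 + norm x) * (1 - norm y)"
      using that assms by (simp add: divide_less_eq less_divide_eq field_simps)
    also have "\<dots> \<longleftrightarrow> norm y < norm x" by (simp add: algebra_simps)
    finally show ?thesis .
  qed
  thus ?thesis using assms by (auto simp: hyp_ball_def)
qed

text \<open>Here \<open>t\<close> is the Euclidean radius, not the geodesic one. The
  \<open>itself\<close> argument supplies the dimension, which a real variable cannot
  determine.\<close>

definition hyp_ball_vol :: "'n::finite itself \<Rightarrow> real \<Rightarrow> real" where
  "hyp_ball_vol _ t = measure hyp_vol (ball 0 t :: (real^'n) set)"

lemma hyp_ball_vol_ratio_eq: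
  fixes x :: "real^'n::finite"
  assumes "norm x < 1"
  shows "hyp_ball_vol_ratio x = hyp_ball_vol TYPE('n) (norm x) / unit_ball_vol (real CARD('n))"
proof -
  have "measure lborel (ball (0 :: real^'n) 1) = unit_ball_vol (real CARD('n))"
    by (simp add: measure_def emeasure_ball)
  thus ?thesis unfolding hyp_ball_vol_ratio_def hyp_ball_vol_def hyp_ball_hyp_rho[OF assms] by simp
qed

lemma hyp_ball_vol_integral:
  assumes "t < 1"
  shows "hyp_ball_vol TYPE('n::finite) t =
    (\<integral>x. indicator (ball (0::real^'n) t) x * (2 / (1 - x \<bullet> x)) ^ CARD('n) \<partial>lborel)"
proof -
  have sub: "ball (0::real^'n) t \<subseteq> ball 0 1" using assms by auto
  have "hyp_ball_vol TYPE('n) t = integral\<^sup>L hyp_vol (indicator (ball (0::real^'n) t))"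
    using sub by (simp add: hyp_ball_vol_def hyp_vol_def space_restrict_space Int_absorb2)
  also have "\<dots> = (\<integral>x. indicator (ball 0 1) x * ((2 / (1 - x \<bullet> x)) ^ CARD('n) * indicator (ball (0::real^'n) t) x) \<partial>lborel)"
    by (intro hyp_vol_integral_eq measurable_restrict_space1 borel_measurable_indicator) simp
  also have "\<dots> = (\<integral>x. indicator (ball (0::real^'n) t) x * (2 / (1 - x \<bullet> x)) ^ CARD('n) \<partial>lborel)"
    using sub by (intro Bochner_Integration.integral_cong) (auto simp: indicator_def)
  finally show ?thesis .
qed

lemma hyp_density_mono:
  fixes x :: "'a::real_inner"
  assumes "norm x \<le> t" "t < 1"
  shows "(2 / (1 - x \<bullet> x)) ^ n \<le> (2 / (1 - t\<^sup>2)) ^ n"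
proof -
  have "x \<bullet> x \<le> t\<^sup>2" unfolding power2_norm_eq_inner[symmetric] using assms by (intro power_mono) auto
  moreover have "t\<^sup>2 < 1" using assms order.trans[OF norm_ge_zero assms(1)] by (simp add: power_less_one_iff)
  ultimately show ?thesis by (intro power_mono frac_le) auto
qed

lemma hyp_density_antimono:
  fixes x :: "'a::real_inner"
  assumes "s \<le> norm x" "norm x < 1" "0 \<le> s"
  shows "(2 / (1 - s\<^sup>2)) ^ n \<le> (2 / (1 - x \<bullet> x)) ^ n"
proof -
  have "s\<^sup>2 \<le> x \<bullet> x" unfolding power2_norm_eq_inner[symmetric] using assms by (intro power_mono) auto
  moreover have "x \<bullet> x < 1" using assms by (simp add: inner_lt_1_iff)
  ultimately show ?thesis by (intro power_mono frac_le divide_nonneg_pos) auto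
qed

text \<open>The density increases with the norm, so on the shell between the two radii it lies
  between its values at \<open>s\<close> and at \<open>t\<close>, while the Euclidean volume of the
  shell is known. These two bounds take the place of integration in polar coordinates.\<close>

lemma hyp_ball_vol_shell:
  assumes st: "0 \<le> s" "s \<le> t" "t < 1"
  defines "n \<equiv> CARD('n::finite)"
  defines "\<sigma> \<equiv> unit_ball_vol (real n)"
  shows "\<sigma> * (2 / (1 - s\<^sup>2)) ^ n * (t ^ n - s ^ n) \<le> hyp_ball_vol TYPE('n) t - hyp_ball_vol TYPE('n) s"
    and "hyp_ball_vol TYPE('n) t - hyp_ball_vol TYPE('n) s \<le> \<sigma> * (2 / (1 - t\<^sup>2)) ^ n * (t ^ n - s ^ n)"
proof -
  let ?w = "\<lambda>x::real^'n. (2 / (1 - x \<bullet> x)) ^ n"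
  let ?d = "\<lambda>x::real^'n. indicator (ball 0 t) x - indicator (ball 0 s) x :: real"
  have i1: "integrable lborel (indicator (ball (0::real^'n) \<rho>) :: _ \<Rightarrow> real)" for \<rho>
    by (intro integrable_real_indicator) (auto intro: emeasure_bounded_finite simp flip: infinity_ennreal_def)
  have m1: "measure lborel (ball (0::real^'n) \<rho>) = \<sigma> * \<rho> ^ n" if "0 \<le> \<rho>" for \<rho>
    using that by (simp add: measure_def emeasure_ball n_def \<sigma>_def)
  have i2: "integrable lborel (\<lambda>x. indicator (ball (0::real^'n) \<rho>) x * ?w x)" if "0 \<le> \<rho>" "\<rho> < 1" for \<rho>
  proof (rule Bochner_Integration.integrable_bound)
    show "integrable lborel (\<lambda>x::real^'n. (2 / (1 - \<rho>\<^sup>2)) ^ n * indicator (ball (0::real^'n) \<rho>) x)"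
      by (intro integrable_mult_right i1)
    show "(\<lambda>x. indicator (ball (0::real^'n) \<rho>) x * ?w x) \<in> borel_measurable lborel"
      by (intro borel_measurable_times borel_measurable_indicator borel_measurable_power borel_measurable_divide borel_measurable_diff borel_measurable_inner) simp_all
    have "\<bar>?w x\<bar> \<le> \<bar>(2 / (1 - \<rho>\<^sup>2)) ^ n\<bar>" if x: "norm x < \<rho>" for x :: "real^'n"
    proof -
      have "0 \<le> ?w x"
        by (rule order.trans[OF zero_le_power[of 2 n]]) (use hyp_density_antimono[of 0 x n] x \<open>\<rho> < 1\<close> in simp_all)
      thus ?thesis using hyp_density_mono[of x \<rho> n] x \<open>\<rho> < 1\<close> by simp
    qed
    thus "AE x in lborel. norm (indicator (ball (0::real^'n) \<rho>) x * ?w x) \<le> norm ((2 / (1 - \<rho>\<^sup>2)) ^ n * indicator (ball (0::real^'n) \<rho>) x)"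
      by (auto simp: indicator_def)
  qed
  have e: "hyp_ball_vol TYPE('n) t - hyp_ball_vol TYPE('n) s = (\<integral>x. ?d x * ?w x \<partial>lborel)"
    using st i2[of t] i2[of s] by (simp add: hyp_ball_vol_integral n_def left_diff_distrib)
  have i3: "integrable lborel (\<lambda>x. ?d x * ?w x)" using st i2[of t] i2[of s] by (simp add: left_diff_distrib)
  have i4: "integrable lborel (\<lambda>x. c * ?d x)" for c using i1 by simp
  have v: "(\<integral>x. c * ?d x \<partial>lborel) = \<sigma> * c * (t ^ n - s ^ n)" for c
    using i1 st m1[of t] m1[of s] by (simp add: algebra_simps)
  show "\<sigma> * (2 / (1 - s\<^sup>2)) ^ n * (t ^ n - s ^ n) \<le> hyp_ball_vol TYPE('n) t - hyp_ball_vol TYPE('n) s"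
    unfolding e v[symmetric]
  proof (intro integral_mono i3 i4)
    fix x :: "real^'n"
    show "(2 / (1 - s\<^sup>2)) ^ n * ?d x \<le> ?d x * ?w x"
    proof (cases "s \<le> norm x \<and> norm x < t")
      case True
      thus ?thesis using hyp_density_antimono[of s x n] st by simp
    qed (use st in \<open>auto simp: indicator_def\<close>)
  qed
  show "hyp_ball_vol TYPE('n) t - hyp_ball_vol TYPE('n) s \<le> \<sigma> * (2 / (1 - t\<^sup>2)) ^ n * (t ^ n - s ^ n)"
    unfolding e v[symmetric]
  proof (intro integral_mono i3 i4)
    fix x :: "real^'n"
    show "?d x * ?w x \<le> (2 / (1 - t\<^sup>2)) ^ n * ?d x"
    proof (cases "s \<le> norm x \<and> norm x < t")
      case True
      thus ?thesis using hyp_density_mono[of x t n] st by simp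
    qed (use st in \<open>auto simp: indicator_def\<close>)
  qed
qed

text \<open>Dividing the shell bounds by \<open>s - t\<close> squeezes the difference quotient of
  the volume between multiples of \<open>D s\<close>, the difference quotient of the n-th power.
  Which endpoint weight serves as the lower one depends on the order of \<open>s\<close> and
  \<open>t\<close>; the minimum and maximum of the two weights cover both orders and have the same
  limit.\<close>

lemma hyp_ball_vol_has_derivative:
  assumes t: "0 < t" "t < 1"
  defines "n \<equiv> CARD('n::finite)"
  defines "\<sigma> \<equiv> unit_ball_vol (real n)"
  shows "(hyp_ball_vol TYPE('n) has_real_derivative \<sigma> * (2 / (1 - t\<^sup>2)) ^ n * (real n * t ^ (n - 1))) (at t)"
proof -
  let ?V = "hyp_ball_vol TYPE('n)"
  define w where "w s = \<sigma> * (2 / (1 - s\<^sup>2)) ^ n" for s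
  define D where "D s = (s ^ n - t ^ n) / (s - t)" for s
  have t2: "1 - t\<^sup>2 \<noteq> 0" using t by (simp add: power2_eq_1_iff)
  have D: "(D \<longlongrightarrow> real n * t ^ (n - 1)) (at t)"
    using DERIV_pow[of n t] unfolding has_field_derivative_iff D_def by simp
  have w: "(w \<longlongrightarrow> w t) (at t)" unfolding w_def using t2 by (intro tendsto_intros)
  have "((\<lambda>s. min (w s) (w t) * D s) \<longlongrightarrow> min (w t) (w t) * (real n * t ^ (n - 1))) (at t)"
    "((\<lambda>s. max (w s) (w t) * D s) \<longlongrightarrow> max (w t) (w t) * (real n * t ^ (n - 1))) (at t)"
    by (intro tendsto_mult tendsto_min tendsto_max tendsto_const w D)+
  hence lims: "((\<lambda>s. min (w s) (w t) * D s) \<longlongrightarrow> w t * (real n * t ^ (n - 1))) (at t)"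
    "((\<lambda>s. max (w s) (w t) * D s) \<longlongrightarrow> w t * (real n * t ^ (n - 1))) (at t)" by simp_all
  have ev: "eventually (\<lambda>s. s \<in> {0<..<1} \<and> s \<noteq> t) (at t)"
    using eventually_at_in_open[of "{0<..<1}" t] t by (auto elim: eventually_mono)
  have sq: "min (w s) (w t) * D s \<le> (?V s - ?V t) / (s - t) \<and> (?V s - ?V t) / (s - t) \<le> max (w s) (w t) * D s"
    if s: "s \<in> {0<..<1} \<and> s \<noteq> t" for s
  proof -
    have D0: "D s \<ge> 0"
    proof (cases "s < t")
      case True thus ?thesis unfolding D_def using s by (intro divide_nonpos_neg) (auto intro: power_mono)
    next
      case False thus ?thesis unfolding D_def using s t by (intro divide_nonneg_nonneg) (auto intro: power_mono)
    qed
    have "\<exists>c d. c * D s \<le> (?V s - ?V t) / (s - t) \<and> (?V s - ?V t) / (s - t) \<le> d * D s \<and> c \<in> {w s, w t} \<and> d \<in> {w s, w t}"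
    proof (cases "s < t")
      case True
      have "w s * (t ^ n - s ^ n) \<le> ?V t - ?V s" "?V t - ?V s \<le> w t * (t ^ n - s ^ n)"
        using hyp_ball_vol_shell[of s t, where ?'n = 'n] True s t by (auto simp: w_def n_def \<sigma>_def)
      hence "w s * ((t ^ n - s ^ n) / (t - s)) \<le> (?V t - ?V s) / (t - s)" "(?V t - ?V s) / (t - s) \<le> w t * ((t ^ n - s ^ n) / (t - s))"
        using True by (auto simp: divide_right_mono)
      moreover have "(t ^ n - s ^ n) / (t - s) = D s" "(?V t - ?V s) / (t - s) = (?V s - ?V t) / (s - t)"
        unfolding D_def by (metis minus_diff_eq minus_divide_divide)+
      ultimately show ?thesis by (intro exI[of _ "w s"] exI[of _ "w t"]) auto
    next
      case False
      have "w t * (s ^ n - t ^ n) \<le> ?V s - ?V t" "?V s - ?V t \<le> w s * (s ^ n - t ^ n)"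
        using hyp_ball_vol_shell[of t s, where ?'n = 'n] False s t by (auto simp: w_def n_def \<sigma>_def)
      hence "w t * D s \<le> (?V s - ?V t) / (s - t)" "(?V s - ?V t) / (s - t) \<le> w s * D s"
        using False by (auto simp: divide_right_mono D_def)
      thus ?thesis by (intro exI[of _ "w t"] exI[of _ "w s"]) auto
    qed
    then obtain c d where cd: "c * D s \<le> (?V s - ?V t) / (s - t)" "(?V s - ?V t) / (s - t) \<le> d * D s" "c \<in> {w s, w t}" "d \<in> {w s, w t}" by blast
    have "min (w s) (w t) * D s \<le> c * D s" "d * D s \<le> max (w s) (w t) * D s"
      using cd D0 by (auto intro!: mult_right_mono)
    thus ?thesis using cd by linarith
  qed
  have "((\<lambda>s. (?V s - ?V t) / (s - t)) \<longlongrightarrow> w t * (real n * t ^ (n - 1))) (at t)"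
    by (rule tendsto_sandwich[OF _ _ lims]) (use ev sq in \<open>auto elim: eventually_mono\<close>)
  thus ?thesis unfolding has_field_derivative_iff w_def .
qed

text \<open>With t = tanh (r/2) the bound is sinh^n r cosh^(-n/2) r, up to the factor
  \<open>\<sigma>\<close>. The difference of the two sides is nondecreasing in the radius because
  its derivative is nonnegative, and the bound tends to 0 at the origin.\<close>

lemma hyp_ball_vol_lower:
  assumes t: "0 < t" "t < 1" and n2: "CARD('n::finite) \<ge> 2"
  defines "n \<equiv> CARD('n)"
  defines "\<sigma> \<equiv> unit_ball_vol (real n)"
  shows "\<sigma> * ((2 * t) ^ n * (1 - t ^ 4) powr (- real n / 2)) \<le> hyp_ball_vol TYPE('n) t"
proof -
  let ?V = "hyp_ball_vol TYPE('n)"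
  define P where "P s = (2 * s) ^ n * (1 - s ^ 4) powr (- real n / 2)" for s :: real
  have sig: "\<sigma> > 0" unfolding \<sigma>_def by simp
  have mono: "?V s - \<sigma> * P s \<le> ?V t - \<sigma> * P t" if s: "0 < s" "s < t" for s
  proof (rule DERIV_nonneg_imp_nondecreasing[of s t])
    show "s \<le> t" using s by simp
    fix x assume x: "s \<le> x" "x \<le> t"
    hence x01: "0 < x" "x < 1" using s t by auto
    have x4: "0 < 1 - x ^ 4" "0 < 1 - x\<^sup>2" using x01 by (auto simp: power_less_one_iff)
    have fact: "1 - x ^ 4 = (1 - x\<^sup>2) * (1 + x\<^sup>2)" by (simp add: algebra_simps flip: power_add)
    define P' where "P' = real n * (2 * x) ^ (n - 1) * 2 * (1 - x ^ 4) powr (- real n / 2 - 1) * (1 + x ^ 4)"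
    have pw: "(1 - x ^ 4) powr (- real n / 2) = (1 - x ^ 4) powr (- real n / 2 - 1) * (1 - x ^ 4)"
      using x4 powr_add[of "1 - x ^ 4" "- real n / 2 - 1" 1] by simp
    have n1: "(2 * x) ^ n = (2 * x) ^ (n - 1) * (2 * x)" using n2 unfolding n_def by (metis One_nat_def Suc_le_D Suc_1 diff_Suc_1 mult.commute power_Suc)
    have dP: "(P has_real_derivative P') (at x)" unfolding P_def P'_def
      apply (rule derivative_eq_intros refl x4)+
      apply (simp only: pw n1)
      apply (simp add: algebra_simps power_numeral_reduce)
      done
    \<comment> \<open>Both derivatives share the factor n 2^n x^(n-1), so this is the comparison
      that remains. Factoring 1 - x^4 leaves a factor in 1 + x^2 that is at most 1, and -n/2 - 1 is
      at least -n because n is at least 2.\<close>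
    have "(1 - x ^ 4) powr (- real n / 2 - 1) * (1 + x ^ 4) \<le> (1 - x\<^sup>2) powr (- real n)"
    proof -
      have "(1 + x\<^sup>2) powr (- real n / 2 - 1) \<le> (1 + x\<^sup>2) powr (-1)" by (intro powr_mono) auto
      also have "\<dots> = 1 / (1 + x\<^sup>2)" by (subst powr_minus) (auto simp: divide_inverse add_nonneg_pos)
      finally have "(1 + x\<^sup>2) powr (- real n / 2 - 1) * (1 + x ^ 4) \<le> 1 / (1 + x\<^sup>2) * (1 + x ^ 4)"
        by (intro mult_right_mono) auto
      also have "\<dots> \<le> 1 / (1 + x\<^sup>2) * (1 + x\<^sup>2)" using x01 by (intro mult_left_mono add_left_mono power_decreasing) auto
      also have "\<dots> = 1" using x4 by (simp add: add_nonneg_eq_0_iff)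
      finally have 1: "(1 + x\<^sup>2) powr (- real n / 2 - 1) * (1 + x ^ 4) \<le> 1" .
      have 2: "(1 - x\<^sup>2) powr (- real n / 2 - 1) \<le> (1 - x\<^sup>2) powr (- real n)"
        using x4 n2 by (intro powr_mono') (auto simp: n_def)
      have "(1 - x ^ 4) powr (- real n / 2 - 1) * (1 + x ^ 4) = (1 - x\<^sup>2) powr (- real n / 2 - 1) * ((1 + x\<^sup>2) powr (- real n / 2 - 1) * (1 + x ^ 4))"
        unfolding fact using x4 by (subst powr_mult) (auto simp: mult_ac)
      also have "\<dots> \<le> (1 - x\<^sup>2) powr (- real n) * 1" using 1 2 by (intro mult_mono) auto
      finally show ?thesis by simp
    qed
    hence "real n * (2 * x) ^ (n - 1) * 2 * ((1 - x ^ 4) powr (- real n / 2 - 1) * (1 + x ^ 4)) \<le> real n * (2 * x) ^ (n - 1) * 2 * (1 - x\<^sup>2) powr (- real n)"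
      using x01 by (intro mult_left_mono) auto
    also have "\<dots> = (2 / (1 - x\<^sup>2)) ^ n * (real n * x ^ (n - 1))"
    proof -
      have "(2::real) ^ n = 2 ^ (n - 1) * 2" using n2 unfolding n_def by (metis One_nat_def Suc_le_D Suc_1 diff_Suc_1 mult.commute power_Suc)
      thus ?thesis using x4 by (simp add: powr_minus powr_realpow power_divide power_mult_distrib divide_inverse power_inverse)
    qed
    finally have le: "P' \<le> (2 / (1 - x\<^sup>2)) ^ n * (real n * x ^ (n - 1))" by (simp add: P'_def mult.assoc)
    have "((\<lambda>s. ?V s - \<sigma> * P s) has_real_derivative \<sigma> * (2 / (1 - x\<^sup>2)) ^ n * (real n * x ^ (n - 1)) - \<sigma> * P') (at x)"
      using hyp_ball_vol_has_derivative[OF x01, where ?'n = 'n] dP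
      by (intro DERIV_diff DERIV_cmult) (auto simp: n_def \<sigma>_def)
    moreover have "\<sigma> * (2 / (1 - x\<^sup>2)) ^ n * (real n * x ^ (n - 1)) - \<sigma> * P' \<ge> 0"
      using mult_left_mono[OF le, of \<sigma>] sig by (simp add: mult_ac)
    ultimately show "\<exists>y. ((\<lambda>s. ?V s - \<sigma> * P s) has_real_derivative y) (at x) \<and> 0 \<le> y" by blast
  qed
  \<comment> \<open>Letting \<open>s\<close> tend to 0 in \<open>mono\<close> only needs the limit
    of \<open>P\<close> and nonnegativity of the volume, not continuity of the volume at 0.\<close>
  have "((\<lambda>s. - (\<sigma> * P s)) \<longlongrightarrow> - (\<sigma> * P 0)) (at_right 0)"
    unfolding P_def by (intro tendsto_intros) auto
  moreover have "P 0 = 0" using n2 by (simp add: P_def n_def)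
  ultimately have lim: "((\<lambda>s. - (\<sigma> * P s)) \<longlongrightarrow> 0) (at_right 0)" by simp
  have "0 \<le> ?V t - \<sigma> * P t"
  proof (rule tendsto_upperbound[OF lim])
    have "- (\<sigma> * P s) \<le> ?V t - \<sigma> * P t" if "s \<in> {0<..<t}" for s
    proof -
      have "?V s \<ge> 0" unfolding hyp_ball_vol_def by simp
      thus ?thesis using mono[of s] that by auto
    qed
    thus "\<forall>\<^sub>F s in at_right 0. - (\<sigma> * P s) \<le> ?V t - \<sigma> * P t"
      using eventually_at_right_real[OF t(1)] by (auto elim: eventually_mono)
  qed auto
  thus ?thesis by (simp add: P_def)
qed

lemma power_powr_divide:
  fixes a c :: real
  assumes "0 < a" "0 < n"
  shows "(a ^ n) powr (c / real n) = a powr c"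
  using assms by (subst powr_realpow[symmetric]) (auto simp: powr_powr)

text \<open>The lower bound equals 1/(z(z+1)) and serves the inequality; it comes from
  \<open>hyp_ball_vol_lower\<close>. The upper bound equals sinh^4 r and serves sharpness; it is the
  shell estimate with inner radius 0.\<close>

lemma hyp_ball_vol_ratio_bounds:
  fixes x :: "real^'n::finite"
  assumes x: "x \<noteq> 0" "norm x < 1" and n2: "CARD('n) \<ge> 2"
  shows "16 * (x \<bullet> x)\<^sup>2 / (1 - (x \<bullet> x)\<^sup>2)\<^sup>2 \<le> hyp_ball_vol_ratio x powr (4 / real CARD('n))"
    and "hyp_ball_vol_ratio x powr (4 / real CARD('n)) \<le> 16 * (x \<bullet> x)\<^sup>2 / (1 - x \<bullet> x) ^ 4"
    and "hyp_ball_vol_ratio x powr (4 / real CARD('n)) > 0"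
proof -
  let ?n = "CARD('n)"
  let ?V = "hyp_ball_vol TYPE('n)"
  define t where "t = norm x"
  define \<sigma> where "\<sigma> = unit_ball_vol (real ?n)"
  have sig: "\<sigma> > 0" unfolding \<sigma>_def by simp
  have t: "0 < t" "t < 1" using x by (auto simp: t_def)
  have N: "x \<bullet> x = t\<^sup>2" by (simp add: t_def power2_norm_eq_inner)
  have t4: "0 < 1 - t ^ 4" "0 < 1 - t\<^sup>2" using t by (auto simp: power_less_one_iff)
  have R: "hyp_ball_vol_ratio x = ?V t / \<sigma>" using hyp_ball_vol_ratio_eq[OF x(2)] by (simp add: t_def \<sigma>_def)
  have lo: "(2 * t) ^ ?n * (1 - t ^ 4) powr (- real ?n / 2) \<le> hyp_ball_vol_ratio x"
    using hyp_ball_vol_lower[OF t n2] sig unfolding R by (simp add: \<sigma>_def field_simps)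
  have p: "0 < (2 * t) ^ ?n * (1 - t ^ 4) powr (- real ?n / 2)" using t t4 by simp
  have "?V 0 = 0" by (simp add: hyp_ball_vol_def)
  hence "?V t \<le> \<sigma> * (2 / (1 - t\<^sup>2)) ^ ?n * t ^ ?n"
    using hyp_ball_vol_shell(2)[of 0 t, where ?'n = 'n] t n2 by (simp add: \<sigma>_def zero_power)
  hence hi: "hyp_ball_vol_ratio x \<le> (2 * t / (1 - t\<^sup>2)) ^ ?n"
    using sig unfolding R by (simp add: field_simps power_mult_distrib power_divide)
  have "((2 * t) ^ ?n * (1 - t ^ 4) powr (- real ?n / 2)) powr (4 / real ?n) \<le> hyp_ball_vol_ratio x powr (4 / real ?n)"
    using lo p by (intro powr_mono2) auto
  moreover have "((2 * t) ^ ?n * (1 - t ^ 4) powr (- real ?n / 2)) powr (4 / real ?n) = 16 * (x \<bullet> x)\<^sup>2 / (1 - (x \<bullet> x)\<^sup>2)\<^sup>2"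
  proof -
    have "((2 * t) ^ ?n) powr (4 / real ?n) = (2 * t) powr 4"
      using t by (intro power_powr_divide) auto
    also have "\<dots> = 16 * t ^ 4" using t by (simp add: powr_numeral power_mult_distrib)
    finally have 1: "((2 * t) ^ ?n) powr (4 / real ?n) = 16 * t ^ 4" .
    have 2: "((1 - t ^ 4) powr (- real ?n / 2)) powr (4 / real ?n) = 1 / (1 - t ^ 4)\<^sup>2"
    proof -
      have "((1 - t ^ 4) powr (- real ?n / 2)) powr (4 / real ?n) = (1 - t ^ 4) powr (- 2)"
        by (simp add: powr_powr)
      also have "\<dots> = 1 / (1 - t ^ 4) powr 2" by (simp add: powr_minus divide_inverse)
      finally show ?thesis using t4 by simp
    qed
    have 3: "(t\<^sup>2)\<^sup>2 = t ^ 4" by (simp flip: power_mult)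
    show ?thesis unfolding powr_mult 1 2 N 3 by simp
  qed
  ultimately show "16 * (x \<bullet> x)\<^sup>2 / (1 - (x \<bullet> x)\<^sup>2)\<^sup>2 \<le> hyp_ball_vol_ratio x powr (4 / real ?n)" by simp
  have "hyp_ball_vol_ratio x powr (4 / real ?n) \<le> ((2 * t / (1 - t\<^sup>2)) ^ ?n) powr (4 / real ?n)"
    using lo p hi by (intro powr_mono2) auto
  also have "\<dots> = (2 * t / (1 - t\<^sup>2)) powr 4"
    using t t4 by (intro power_powr_divide) auto
  also have "\<dots> = 16 * (x \<bullet> x)\<^sup>2 / (1 - x \<bullet> x) ^ 4"
    using t t4 unfolding N by (simp add: powr_numeral power_divide power_mult_distrib flip: power_mult)
  finally show "hyp_ball_vol_ratio x powr (4 / real ?n) \<le> 16 * (x \<bullet> x)\<^sup>2 / (1 - x \<bullet> x) ^ 4" .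
  show "hyp_ball_vol_ratio x powr (4 / real ?n) > 0" using lo p by simp
qed

text \<open>On the ball the ratio is a monotone function of the norm, and monotone real functions
  are Borel. Monotonicity follows from the lower shell bound.\<close>

lemma hyp_ball_vol_ratio_measurable:
  "(hyp_ball_vol_ratio :: real^'n::finite \<Rightarrow> real) \<in> borel_measurable (restrict_space lborel (ball 0 1))"
proof -
  have "mono_on {0..<1} (hyp_ball_vol TYPE('n))"
  proof (rule mono_onI)
    fix s t :: real assume "s \<in> {0..<1}" "t \<in> {0..<1}" "s \<le> t"
    hence st: "0 \<le> s" "s \<le> t" "t < 1" by auto
    have "s\<^sup>2 \<le> 1" using st by (simp add: power_le_one)
    hence "0 \<le> unit_ball_vol (real CARD('n)) * (2 / (1 - s\<^sup>2)) ^ CARD('n) * (t ^ CARD('n) - s ^ CARD('n))"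
      using st by (intro mult_nonneg_nonneg zero_le_power divide_nonneg_nonneg) (auto intro: power_mono)
    thus "hyp_ball_vol TYPE('n) s \<le> hyp_ball_vol TYPE('n) t" using hyp_ball_vol_shell(1)[OF st, where ?'n = 'n] by linarith
  qed
  hence 1: "hyp_ball_vol TYPE('n) \<in> borel_measurable (restrict_space borel {0..<1})"
    by (rule borel_measurable_mono_on_fnc)
  have 2: "norm \<in> measurable (restrict_space lborel (ball (0::real^'n) 1)) (restrict_space borel {0..<1})"
    by (rule measurable_restrict_space2) (auto simp: space_restrict_space intro!: measurable_restrict_space1)
  have "(\<lambda>x::real^'n. hyp_ball_vol TYPE('n) (norm x) / unit_ball_vol (real CARD('n))) \<in> borel_measurable (restrict_space lborel (ball 0 1))"
    by (intro borel_measurable_divide measurable_compose[OF 2 1]) auto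
  thus ?thesis
    by (subst measurable_cong[where g = "\<lambda>x::real^'n. hyp_ball_vol TYPE('n) (norm x) / unit_ball_vol (real CARD('n))"])
      (auto simp: space_restrict_space hyp_ball_vol_ratio_eq)
qed

section \<open>The Rellich inequality\<close>

text \<open>In the variable \<open>N = |x|\<^sup>2\<close> of the ball model: \<open>w\<close> is the conformal factor, \<open>z = 1/sinh\<^sup>2 r\<close>,
  \<open>l\<close> is the derivative of \<open>ln \<theta>\<close>, and primes denote
  derivatives in \<open>N\<close>.\<close>

lemma scalar_inequality:
  fixes n N :: real
  assumes n: "n \<ge> 5" and N: "0 < N" "N < 1"
  defines "b \<equiv> (n - 1)\<^sup>2 / 4" and "k \<equiv> n * (n - 4) / 4"
  defines "z \<equiv> (1 - N)\<^sup>2 / (4 * N)" and "w \<equiv> 2 / (1 - N)"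
  defines "q \<equiv> b + k * z" 
  defines "q' \<equiv> k * (1 - 1 / N\<^sup>2) / 4"
  defines "l \<equiv> 1 / (2 * (1 + N)) - (n - 1) / (2 * (1 - N)) - n / (4 * N)"
  defines "l' \<equiv> - 1 / (2 * (1 + N)\<^sup>2) - (n - 1) / (2 * (1 - N)\<^sup>2) + n / (4 * N\<^sup>2)"
  defines "g \<equiv> - 2 * q' + 4 * q * l"
  defines "g' \<equiv> - k / N ^ 3 + 4 * q' * l + 4 * q * l'"
  shows "- 8 * N * (q' - q * l)\<^sup>2 / q - q\<^sup>2 * w\<^sup>2 - (2 * N * g' + (n - 2) * w * N * g + n * g)
    \<ge> w\<^sup>2 * (b\<^sup>2 + k\<^sup>2 * (z * (z + 1)))"
proof -
  have k: "k > 0" using n by (simp add: k_def)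
  have b: "b > 0" using n by (simp add: b_def)
  have z: "z > 0" using N by (simp add: z_def)
  have q: "q > 0" using k b z by (simp add: q_def add_pos_pos)
  have kb: "k \<le> b" using n by (simp add: k_def b_def power2_eq_square field_simps)
  have z1: "1 + z = (1 + N)\<^sup>2 / (4 * N)" using N by (simp add: z_def field_simps power2_eq_square)
  \<comment> \<open>In terms of L = -\<Delta>\<open>\<^sub>g\<close> and \<phi> = \<theta>/q, the
    first summand is q L\<theta>/\<theta> and the second is q (L\<phi>/\<phi> - q). So the second is
    nonnegative exactly when L\<phi> \<ge> \<theta>, and the first has to dominate the
    potential.\<close>
  define E where "E = q * (b + k * z - z / (4 * (1 + z))) + (z / q) * (- q\<^sup>2 / (4 * (1 + z)) + 4 * k * b + (8 * k * b - 4 * k\<^sup>2) * z)"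
  have "q * (- 8 * N * (q' - q * l)\<^sup>2 / q - q\<^sup>2 * w\<^sup>2 - (2 * N * g' + (n - 2) * w * N * g + n * g)) = q * (w\<^sup>2 * E)"
  proof -
    have nz: "N \<noteq> 0" "1 - N \<noteq> 0" "1 + N \<noteq> 0" using N by auto
    have L: "q * (- 8 * N * (q' - q * l)\<^sup>2 / q - q\<^sup>2 * w\<^sup>2 - (2 * N * g' + (n - 2) * w * N * g + n * g))
      = - 8 * N * (q' - q * l)\<^sup>2 - q * q\<^sup>2 * w\<^sup>2 - q * (2 * N * g' + (n - 2) * w * N * g + n * g)" using q by (simp add: field_simps)
    have R: "q * (w\<^sup>2 * E) = w\<^sup>2 * (q\<^sup>2 * (b + k * z - z / (4 * (1 + z))) + z * (- q\<^sup>2 / (4 * (1 + z)) + 4 * k * b + (8 * k * b - 4 * k\<^sup>2) * z))"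
      using q by (simp add: E_def field_simps power2_eq_square)
    show ?thesis unfolding L R unfolding z1 g_def g'_def q_def q'_def l_def l'_def w_def z_def k_def b_def
      using nz apply (simp add: divide_simps) apply algebra done
  qed
  hence eq: "- 8 * N * (q' - q * l)\<^sup>2 / q - q\<^sup>2 * w\<^sup>2 - (2 * N * g' + (n - 2) * w * N * g + n * g) = w\<^sup>2 * E" using q by simp
  have "E \<ge> b\<^sup>2 + k\<^sup>2 * (z * (z + 1))"
  proof -
    have qb: "q \<le> b * (1 + z)" using mult_right_mono[OF kb, of z] z by (simp add: q_def algebra_simps)
    have k54: "k \<ge> 1" using n mult_mono[of 5 n 1 "n - 4"] by (simp add: k_def)
    \<comment> \<open>This absorbs the negative term: q^2/(4(1+z)) is at most b^2 (1+z)/4, hence at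
      most 4kb(1+z). The polynomial inequality behind it is 15 n^2 - 62 n \<ge> 1.\<close>
    have b16: "b \<le> 16 * k"
    proof -
      have "(15 * n - 62) * n \<ge> (15 * 5 - 62) * 5" using n by (intro mult_mono) auto
      thus ?thesis by (simp add: b_def k_def power2_eq_square field_simps)
    qed
    have "q\<^sup>2 \<le> (b * (1 + z))\<^sup>2" using qb q by (intro power_mono) auto
    hence "q\<^sup>2 / (4 * (1 + z)) \<le> (b * (1 + z))\<^sup>2 / (4 * (1 + z))" using z by (intro divide_right_mono) auto
    also have "\<dots> = b * b * (1 + z) / 4" using z by (simp add: power2_eq_square field_simps)
    also have "\<dots> \<le> 16 * k * b * (1 + z) / 4" using b16 b z by (intro divide_right_mono mult_right_mono) auto
    also have "\<dots> = 4 * k * b + 4 * k * b * z" by (simp add: algebra_simps)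
    also have "\<dots> \<le> 4 * k * b + (8 * k * b - 4 * k\<^sup>2) * z"
      using mult_left_mono[OF kb, of "k * z"] k z by (simp add: power2_eq_square algebra_simps)
    finally have 1: "(z / q) * (- q\<^sup>2 / (4 * (1 + z)) + 4 * k * b + (8 * k * b - 4 * k\<^sup>2) * z) \<ge> 0"
      using z q by (intro mult_nonneg_nonneg) auto
    \<comment> \<open>Expanding q^2 produces the cross term 2kbz. One copy of kbz pays for the loss
      q z/(4(1+z)), the other dominates the term k^2 z of the potential.\<close>
    have "q * (z / (4 * (1 + z))) \<le> b * (1 + z) * (z / (4 * (1 + z)))" using qb z by (intro mult_right_mono) auto
    also have "\<dots> = b * z / 4" using z by (simp add: field_simps)
    also have "\<dots> \<le> k * b * z" using mult_right_mono[OF k54, of "b * z"] b z by (simp add: algebra_simps)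
    finally have 2: "q * (z / (4 * (1 + z))) \<le> k * b * z" .
    have 3: "k * k * z \<le> k * b * z" using kb k z by simp
    have "q * (b + k * z - z / (4 * (1 + z))) = b\<^sup>2 + k\<^sup>2 * z\<^sup>2 + 2 * (k * b * z) - q * (z / (4 * (1 + z)))"
      unfolding right_diff_distrib by (simp add: q_def power2_eq_square algebra_simps)
    thus ?thesis using 1 2 3 unfolding E_def by (simp add: power2_eq_square algebra_simps)
  qed
  thus ?thesis unfolding eq by (intro mult_left_mono) auto
qed

text \<open>The bracket multiplied by \<open>w ^ (n - 2)\<close> is the divergence of the field
  w^(n-2) (-2 q u \<nabla>u + g u^2 x), so after integration only the potential term survives on the
  left. The inequality is the sum of two nonnegative squares and the scalar inequality
  \<open>scal\<close>; the choice of \<open>g\<close> makes the mixed terms in \<open>u * D\<close>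
  cancel.\<close>

lemma rellich_pointwise:
  fixes x Du :: "'a::real_inner" and n :: nat and q q' g g' l w V u L :: real
  assumes w: "w > 0" and q: "q > 0" and n: "n \<ge> 2"
    and g: "g = - 2 * q' + 4 * q * l"
    and scal: "w\<^sup>2 * V \<le> - 8 * (x \<bullet> x) * (q' - q * l)\<^sup>2 / q - q\<^sup>2 * w\<^sup>2
      - (2 * (x \<bullet> x) * g' + (real n - 2) * w * (x \<bullet> x) * g + real n * g)"
  defines "D \<equiv> x \<bullet> Du" and "E \<equiv> Du \<bullet> Du"
  shows "w ^ (n - 2) * (2 * (- (real n - 2) * w * q - 2 * q') * u * D - 2 * q * E - 2 * q * u * L
      + (2 * (x \<bullet> x) * ((real n - 2) / 2 * w * g + g') + real n * g) * u\<^sup>2 + 2 * g * u * D) + w ^ n * (u\<^sup>2 * V)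
    \<le> w ^ n * (L / w\<^sup>2 + (real n - 2) * D / w)\<^sup>2"
proof -
  define N where "N = x \<bullet> x"
  define c where "c = q' - q * l"
  define h where "h = L / w\<^sup>2 + (real n - 2) * D / w"
  \<comment> \<open>The vector is q (\<nabla>u - u \<nabla>\<phi>/\<phi>): the logarithmic
    derivative of \<phi> = \<theta>/q in N is l - q'/q = -c/q, and the gradient of N is 2x.\<close>
  have "0 \<le> (q *\<^sub>R Du + (2 * c * u) *\<^sub>R x) \<bullet> (q *\<^sub>R Du + (2 * c * u) *\<^sub>R x)" by (rule inner_ge_zero)
  also have "\<dots> = q\<^sup>2 * E + 4 * c * u * q * D + 4 * c\<^sup>2 * u\<^sup>2 * N"
    by (simp add: D_def E_def N_def inner_add inner_commute[of Du x] power2_eq_square algebra_simps)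
  finally have "0 \<le> (2 / q) * (q\<^sup>2 * E + 4 * c * u * q * D + 4 * c\<^sup>2 * u\<^sup>2 * N)" using q by simp
  also have "\<dots> = 2 * q * E + 8 * c * u * D + u\<^sup>2 * (8 * N * c\<^sup>2 / q)"
    using q by (simp add: power2_eq_square field_simps)
  finally have 1: "0 \<le> 2 * q * E + 8 * c * u * D + u\<^sup>2 * (8 * N * c\<^sup>2 / q)" .
  \<comment> \<open>Since \<open>h\<close> stands for \<Delta>\<open>\<^sub>g\<close>u = -Lu, this
    is the square of Lu - qu.\<close>
  have "0 \<le> w\<^sup>2 * (h + q * u)\<^sup>2" by simp
  also have "\<dots> = w\<^sup>2 * h\<^sup>2 + 2 * q * u * (w\<^sup>2 * h) + q\<^sup>2 * u\<^sup>2 * w\<^sup>2" by (simp add: power2_eq_square algebra_simps)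
  also have "w\<^sup>2 * h = L + (real n - 2) * w * D" using w by (simp add: h_def power2_eq_square field_simps)
  finally have 2: "- 2 * q * u * (L + (real n - 2) * w * D) - q\<^sup>2 * u\<^sup>2 * w\<^sup>2 \<le> w\<^sup>2 * h\<^sup>2" by simp
  have 3: "u\<^sup>2 * (w\<^sup>2 * V) \<le> u\<^sup>2 * (- 8 * N * c\<^sup>2 / q - q\<^sup>2 * w\<^sup>2 - (2 * N * g' + (real n - 2) * w * N * g + real n * g))"
    using scal unfolding N_def c_def by (intro mult_left_mono) auto
  have "2 * (- (real n - 2) * w * q - 2 * q') * u * D - 2 * q * E - 2 * q * u * L
      + (2 * N * ((real n - 2) / 2 * w * g + g') + real n * g) * u\<^sup>2 + 2 * g * u * D + u\<^sup>2 * (w\<^sup>2 * V) \<le> w\<^sup>2 * h\<^sup>2"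
  proof -
    have gD: "2 * g * u * D = 4 * q' * u * D - 8 * c * u * D" unfolding g c_def by (simp add: algebra_simps)
    have gN: "2 * N * ((real n - 2) / 2 * w * g + g') = N * (real n - 2) * w * g + 2 * N * g'"
      by (simp add: field_simps)
    show ?thesis using 1 2 3 unfolding gD gN by (simp add: algebra_simps)
  qed
  hence "w ^ (n - 2) * (2 * (- (real n - 2) * w * q - 2 * q') * u * D - 2 * q * E - 2 * q * u * L
      + (2 * N * ((real n - 2) / 2 * w * g + g') + real n * g) * u\<^sup>2 + 2 * g * u * D + u\<^sup>2 * (w\<^sup>2 * V)) \<le> w ^ (n - 2) * (w\<^sup>2 * h\<^sup>2)"
    using w by (intro mult_left_mono) auto
  moreover have "w ^ n = w ^ (n - 2) * w\<^sup>2" using n by (metis le_add_diff_inverse2 power_add)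
  ultimately show ?thesis unfolding h_def N_def by (simp add: algebra_simps)
qed

text \<open>The singular coefficients of the scalar inequality, multiplied by the power of \<open>t\<close> that makes them
  smooth at the origin: \<open>rellich_q\<close> is \<open>t q\<close>, \<open>rellich_l\<close> is \<open>t l\<close>, \<open>rellich_g\<close> is \<open>t\<^sup>2 g\<close>.\<close>

context
  fixes n :: nat
begin

definition "rellich_b = (real n - 1)\<^sup>2 / 4"
definition "rellich_k = real n * (real n - 4) / 4"
definition "rellich_q t = rellich_b * t + rellich_k * (1 - t)\<^sup>2 / 4"
definition "rellich_q' t = rellich_b - rellich_k * (1 - t) / 2"
definition "rellich_l t = t / (2 * (1 + t)) - (real n - 1) * t / (2 * (1 - t)) - real n / 4"
definition "rellich_l' t = 1 / (2 * (1 + t)\<^sup>2) - (real n - 1) / (2 * (1 - t)\<^sup>2)"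
definition "rellich_g t = - rellich_k * (t\<^sup>2 - 1) / 2 + 4 * rellich_q t * rellich_l t"
definition "rellich_g' t = - rellich_k * t + 4 * rellich_q' t * rellich_l t + 4 * rellich_q t * rellich_l' t"
text \<open>The field to be integrated has the coefficients A/t = -2 w^(n-2) q and B/t^2 = w^(n-2)
  g. The power w^(n-2) combines the volume density w^n with the factor w^-2 of the inverse
  metric.\<close>

definition "rellich_A t = - 2 * (2 / (1 - t)) ^ (n - 2) * rellich_q t"
definition "rellich_A' t = - (real n - 2) * (2 / (1 - t)) ^ (n - 1) * rellich_q t - 2 * (2 / (1 - t)) ^ (n - 2) * rellich_q' t"
definition "rellich_B t = (2 / (1 - t)) ^ (n - 2) * rellich_g t"
definition "rellich_B' t = (real n - 2) / 2 * (2 / (1 - t)) ^ (n - 1) * rellich_g t + (2 / (1 - t)) ^ (n - 2) * rellich_g' t"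

lemma DERIV_rellich_w:
  assumes "n \<ge> 5" "0 \<le> t" "t < 1"
  shows "((\<lambda>t. (2 / (1 - t)) ^ (n - 2)) has_real_derivative (real n - 2) / 2 * (2 / (1 - t)) ^ (n - 1)) (at t)"
proof -
  have "((\<lambda>t. 2 / (1 - t)) has_real_derivative 2 / (1 - t)\<^sup>2) (at t)"
    using assms by (auto intro!: derivative_eq_intros simp: power2_eq_square)
  from DERIV_power[OF this, of "n - 2"] have D:
    "((\<lambda>t. (2 / (1 - t)) ^ (n - 2)) has_real_derivative real (n - 2) * (2 / (1 - t)\<^sup>2 * (2 / (1 - t)) ^ (n - 3))) (at t)"
    by (simp add: numeral_3_eq_3)
  have e: "2 / (1 - t)\<^sup>2 * (2 / (1 - t)) ^ (n - 3) = (2 / (1 - t)) ^ (n - 1) / 2"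
  proof -
    have "n - 1 = 2 + (n - 3)" using assms(1) by simp
    thus ?thesis by (simp only: power_add) (simp add: power_divide)
  qed
  show ?thesis using D assms(1) unfolding e by (simp add: of_nat_diff)
qed

lemma DERIV_rellich_q: "(rellich_q has_real_derivative rellich_q' t) (at t)"
  unfolding rellich_q_def rellich_q'_def by (auto intro!: derivative_eq_intros simp: power2_eq_square field_simps)

lemma DERIV_rellich_l:
  assumes "0 \<le> t" "t < 1"
  shows "(rellich_l has_real_derivative rellich_l' t) (at t)"
proof -
  have "((\<lambda>t. t / (2 * (1 + t))) has_real_derivative 1 / (2 * (1 + t)\<^sup>2)) (at t)"
    using assms by (auto intro!: derivative_eq_intros simp: divide_simps power2_eq_square) (simp add: algebra_simps)
  moreover have "((\<lambda>t. t / (2 * (1 - t))) has_real_derivative 1 / (2 * (1 - t)\<^sup>2)) (at t)"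
    using assms by (auto intro!: derivative_eq_intros simp: divide_simps power2_eq_square) (simp add: algebra_simps)
  ultimately have "((\<lambda>t. t / (2 * (1 + t)) - (real n - 1) * (t / (2 * (1 - t))) - real n / 4) has_real_derivative
      1 / (2 * (1 + t)\<^sup>2) - (real n - 1) * (1 / (2 * (1 - t)\<^sup>2)) - 0) (at t)"
    by (intro DERIV_diff DERIV_cmult DERIV_const)
  thus ?thesis unfolding rellich_l_def rellich_l'_def by simp
qed

lemma DERIV_rellich_g:
  assumes "0 \<le> t" "t < 1"
  shows "(rellich_g has_real_derivative rellich_g' t) (at t)"
  unfolding rellich_g_def rellich_g'_def
  by (auto intro!: derivative_eq_intros DERIV_rellich_q DERIV_rellich_l assms simp: field_simps)

lemma DERIV_rellich_A:
  assumes "n \<ge> 5" "0 \<le> t" "t < 1"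
  shows "(rellich_A has_real_derivative rellich_A' t) (at t)"
  unfolding rellich_A_def[abs_def] rellich_A'_def
  by (rule DERIV_cong[OF DERIV_mult[OF DERIV_cmult[OF DERIV_rellich_w[OF assms], of "- 2"] DERIV_rellich_q[of t]]]) (simp add: algebra_simps diff_divide_distrib)

lemma DERIV_rellich_B:
  assumes "n \<ge> 5" "0 \<le> t" "t < 1"
  shows "(rellich_B has_real_derivative rellich_B' t) (at t)"
  unfolding rellich_B_def[abs_def] rellich_B'_def
  by (rule DERIV_cong[OF DERIV_mult[OF DERIV_rellich_w[OF assms] DERIV_rellich_g[OF assms(2,3)]]]) (simp add: algebra_simps)

lemma continuous_on_rellich_A': "continuous_on {0..<1} rellich_A'"
  unfolding rellich_A'_def rellich_q_def rellich_q'_def by (intro continuous_intros) auto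

lemma continuous_on_rellich_B': "continuous_on {0..<1} rellich_B'"
  unfolding rellich_B'_def rellich_g_def rellich_g'_def rellich_l_def rellich_l'_def rellich_q_def rellich_q'_def
  by (intro continuous_intros) (auto simp: add_nonneg_eq_0_iff)

text \<open>Translates the scaled coefficients, which the divergence theorem can handle at the
  origin, back into \<open>q\<close>, \<open>l\<close> and \<open>g\<close>, where
  \<open>scalar_inequality\<close> and \<open>rellich_pointwise\<close> apply. The potential takes
  its final form through z(z+1) = (1-N^2)^2/(16 N^2).\<close>

lemma rellich_radial_div:
  fixes u :: "real^'m::finite \<Rightarrow> real"
  assumes n5: "n \<ge> 5" and m: "CARD('m) = n" and x: "x \<noteq> 0" "norm x < 1"
  defines "N \<equiv> x \<bullet> x"
  shows "radial_div (rellich_A N / N) (rellich_A' N / N - rellich_A N / N\<^sup>2) (rellich_B N / N\<^sup>2) (rellich_B' N / N\<^sup>2 - 2 * rellich_B N / N ^ 3) u x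
    + (2 / (1 - N)) ^ n * ((u x)\<^sup>2 * (rellich_b\<^sup>2 + rellich_k\<^sup>2 * ((1 - N\<^sup>2)\<^sup>2 / (16 * N\<^sup>2))))
    \<le> (2 / (1 - N)) ^ n * (hyp_laplacian u x)\<^sup>2"
proof -
  have N: "0 < N" "N < 1" using x unfolding N_def by (simp_all add: inner_lt_1_iff)
  define w where "w = 2 / (1 - N)"
  have w: "w > 0" using N by (simp add: w_def)
  define z where "z = (1 - N)\<^sup>2 / (4 * N)"
  define q where "q = rellich_b + rellich_k * z"
  define q' where "q' = rellich_k * (1 - 1 / N\<^sup>2) / 4"
  define l where "l = 1 / (2 * (1 + N)) - (real n - 1) / (2 * (1 - N)) - real n / (4 * N)"
  define l' where "l' = - 1 / (2 * (1 + N)\<^sup>2) - (real n - 1) / (2 * (1 - N)\<^sup>2) + real n / (4 * N\<^sup>2)"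
  define g where "g = - 2 * q' + 4 * q * l"
  define g' where "g' = - rellich_k / N ^ 3 + 4 * q' * l + 4 * q * l'"
  have k: "rellich_k > 0" "rellich_b > 0" using n5 by (auto simp: rellich_k_def rellich_b_def)
  have q: "q > 0" using k N unfolding q_def z_def by (intro add_pos_nonneg) auto
  have n5': "real n \<ge> 5" using n5 by simp
  have scal: "w\<^sup>2 * (rellich_b\<^sup>2 + rellich_k\<^sup>2 * (z * (z + 1))) \<le> - 8 * N * (q' - q * l)\<^sup>2 / q - q\<^sup>2 * w\<^sup>2 - (2 * N * g' + (real n - 2) * w * N * g + real n * g)"
    using scalar_inequality[OF n5' N]
    unfolding g_def g'_def q_def q'_def l_def l'_def w_def z_def rellich_b_def rellich_k_def .
  have zz: "z * (z + 1) = (1 - N\<^sup>2)\<^sup>2 / (16 * N\<^sup>2)"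
  proof -
    have "z + 1 = (1 + N)\<^sup>2 / (4 * N)" using N by (simp add: z_def field_simps power2_eq_square)
    hence "z * (z + 1) = ((1 - N) * (1 + N))\<^sup>2 / (16 * N\<^sup>2)" by (simp add: z_def power2_eq_square)
    also have "(1 - N) * (1 + N) = 1 - N\<^sup>2" by (simp add: power2_eq_square algebra_simps)
    finally show ?thesis .
  qed
  have rellich_q: "rellich_q N = N * q" using N by (simp add: rellich_q_def q_def z_def field_simps)
  have rellich_q': "rellich_q' N = q + N * q'" using N by (simp add: rellich_q'_def q_def q'_def z_def field_simps power2_eq_square)
  have rellich_l: "rellich_l N = N * l"
  proof -
    have "1 + N \<noteq> 0" "1 - N \<noteq> 0" "N \<noteq> 0" using N by auto
    thus ?thesis unfolding rellich_l_def l_def by (simp add: divide_simps) (simp add: algebra_simps)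
  qed
  have rellich_l': "rellich_l' N = l + N * l'"
  proof -
    have "1 + N \<noteq> 0" "1 - N \<noteq> 0" "N \<noteq> 0" using N by auto
    thus ?thesis unfolding rellich_l'_def l_def l'_def by (simp add: divide_simps power2_eq_square) (simp add: algebra_simps)
  qed
  have rellich_g: "rellich_g N = N\<^sup>2 * g" using N unfolding rellich_g_def g_def rellich_q rellich_l q'_def by (simp add: field_simps power2_eq_square)
  have rellich_g': "rellich_g' N = 2 * N * g + N\<^sup>2 * g'"
  proof -
    have "- rellich_k * N = - 4 * N * q' - N\<^sup>2 * (rellich_k / N ^ 3)" using N by (simp add: q'_def field_simps power2_eq_square power3_eq_cube)
    thus ?thesis unfolding rellich_g'_def g_def g'_def rellich_q rellich_l rellich_q' rellich_l' by (simp add: algebra_simps power2_eq_square)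
  qed
  have w1: "w ^ (n - 1) = w ^ (n - 2) * w" 
  proof -
    have "n - 1 = Suc (n - 2)" using n5 by simp
    thus ?thesis by (simp only: power_Suc2)
  qed
  have a1: "rellich_A N / N = - 2 * w ^ (n - 2) * q" using N by (simp add: rellich_A_def rellich_q w_def)
  have a2: "rellich_A' N / N - rellich_A N / N\<^sup>2 = w ^ (n - 2) * (- (real n - 2) * w * q - 2 * q')"
    using N unfolding rellich_A_def rellich_A'_def rellich_q rellich_q' w_def[symmetric] w1 by (simp add: field_simps power2_eq_square)
  have b1: "rellich_B N / N\<^sup>2 = w ^ (n - 2) * g" using N by (simp add: rellich_B_def rellich_g w_def)
  have b2: "rellich_B' N / N\<^sup>2 - 2 * rellich_B N / N ^ 3 = w ^ (n - 2) * ((real n - 2) / 2 * w * g + g')"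
    using N unfolding rellich_B_def rellich_B'_def rellich_g rellich_g' w_def[symmetric] w1 by (simp add: field_simps power2_eq_square power3_eq_cube)
  have hl: "hyp_laplacian u x = laplacian u x / w\<^sup>2 + (real n - 2) * (x \<bullet> gradient u x) / w"
    unfolding hyp_laplacian_def m w_def power2_norm_eq_inner N_def[symmetric] using N by (simp add: power_divide mult_ac)
  have "w ^ (n - 2) * (2 * (- (real n - 2) * w * q - 2 * q') * u x * (x \<bullet> gradient u x) - 2 * q * (gradient u x \<bullet> gradient u x) - 2 * q * u x * laplacian u x
      + (2 * N * ((real n - 2) / 2 * w * g + g') + real n * g) * (u x)\<^sup>2 + 2 * g * u x * (x \<bullet> gradient u x)) + w ^ n * ((u x)\<^sup>2 * (rellich_b\<^sup>2 + rellich_k\<^sup>2 * (z * (z + 1))))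
    \<le> w ^ n * (laplacian u x / w\<^sup>2 + (real n - 2) * (x \<bullet> gradient u x) / w)\<^sup>2"
    unfolding N_def by (rule rellich_pointwise[OF w q _ g_def scal[unfolded N_def]]) (use n5 in simp)
  thus ?thesis unfolding radial_div_def hl zz N_def[symmetric] w_def[symmetric] a1 a2 b1 b2 m
    by (simp add: algebra_simps)
qed

end

section \<open>Integrability of the terms, and the integrated inequality\<close>

lemma continuous_measurable_ball:
  fixes f :: "real^'n::finite \<Rightarrow> real"
  shows "continuous_on UNIV f \<Longrightarrow> f \<in> borel_measurable (restrict_space lborel (ball 0 1))"
  by (intro measurable_restrict_space1) (simp add: borel_measurable_continuous_onI)

lemma hyp_vol_integrable_continuous:
  fixes f :: "real^'n::finite \<Rightarrow> real"
  assumes f: "continuous_on UNIV f" "r < 1" "\<And>x. norm x > r \<Longrightarrow> f x = 0"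
  shows "integrable hyp_vol f"
proof -
  have "continuous_on {0..<1} (\<lambda>t::real. (2 / (1 - t)) ^ CARD('n))" by (intro continuous_intros) auto
  from continuous_on_comp_norm_square_mult[OF this f]
  have "integrable lborel (\<lambda>x. (2 / (1 - x \<bullet> x)) ^ CARD('n) * f x)"
    by (rule integrable_compact_support[of _ r]) (use f in auto)
  moreover have "(\<lambda>x. (2 / (1 - x \<bullet> x)) ^ CARD('n) * f x) = (\<lambda>x. indicator (ball 0 1) x * ((2 / (1 - x \<bullet> x)) ^ CARD('n) * f x))"
    using f by (auto simp: fun_eq_iff indicator_def)
  ultimately show ?thesis by (simp add: hyp_vol_integrable_iff[OF continuous_measurable_ball[OF f(1)]])
qed

lemma continuous_on_hyp_laplacian:
  assumes "test_fun r u" "r < 1"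
  shows "continuous_on UNIV (hyp_laplacian u)"
  unfolding hyp_laplacian_def by (intro continuous_intros test_fun_continuous_all[OF assms]) auto

lemma hyp_laplacian_zero:
  assumes "test_fun r u" "norm x > r"
  shows "hyp_laplacian u x = 0"
  using test_fun_laplacian_zero[OF assms] by (simp add: hyp_laplacian_def)

lemma rellich_weight_measurable:
  fixes u :: "real^'n::finite \<Rightarrow> real"
  assumes "continuous_on UNIV u"
  shows "(\<lambda>x. (u x)\<^sup>2 / hyp_ball_vol_ratio x powr (4 / real CARD('n))) \<in> borel_measurable (restrict_space lborel (ball 0 1))"
  by (intro borel_measurable_divide borel_measurable_power powr_real_measurable
      continuous_measurable_ball assms hyp_ball_vol_ratio_measurable) simp

text \<open>The lower bound on the ratio gives \<open>?N\<^sup>2 \<le> ?R x\<close>, so the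
  integrand with its density is at most M/|x|^4, which is integrable on the ball for n at least
  5.\<close>

lemma rellich_weight_integrable:
  fixes u :: "real^'n::finite \<Rightarrow> real"
  assumes u: "test_fun r u" "r < 1" and n: "CARD('n) \<ge> 5"
  shows "integrable hyp_vol (\<lambda>x. (u x)\<^sup>2 / hyp_ball_vol_ratio x powr (4 / real CARD('n)))"
proof -
  let ?R = "\<lambda>x::real^'n. hyp_ball_vol_ratio x powr (4 / real CARD('n))"
  note cu = test_fun_continuous[OF u]
  note m = rellich_weight_measurable[OF cu]
  have cw: "continuous_on {0..<1} (\<lambda>t::real. (2 / (1 - t)) ^ CARD('n))" by (intro continuous_intros) auto
  obtain M where M: "M \<ge> 0" "\<And>x. \<bar>(2 / (1 - x \<bullet> x)) ^ CARD('n) * (u x)\<^sup>2\<bar> \<le> M"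
    by (rule bounded_comp_norm_square_mult[OF cw, of "\<lambda>x. (u x)\<^sup>2" r])
      (use u test_fun_zero[OF u(1)] in \<open>auto intro!: continuous_intros cu\<close>)
  have mw: "(\<lambda>x::real^'n. (2 / (1 - x \<bullet> x)) ^ CARD('n)) \<in> borel_measurable (restrict_space lborel (ball 0 1))"
    using hyp_vol_density_measurable by (simp add: power2_norm_eq_inner)
  have m2: "(\<lambda>x. indicator (ball 0 1) x * ((2 / (1 - x \<bullet> x)) ^ CARD('n) * ((u x)\<^sup>2 / ?R x))) \<in> borel_measurable lborel"
    using borel_measurable_times[OF mw m] by (simp add: borel_measurable_restrict_space_iff)
  have "integrable lborel (\<lambda>x. indicator (ball 0 1) x * ((2 / (1 - x \<bullet> x)) ^ CARD('n) * ((u x)\<^sup>2 / ?R x)))"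
  proof (rule Bochner_Integration.integrable_bound)
    show "integrable lborel (\<lambda>x::real^'n. M * (indicator (ball 0 1) x / (x \<bullet> x)\<^sup>2))"
      by (intro integrable_mult_right integrable_inverse_norm_power4) (use n in simp)
    have "\<bar>(2 / (1 - x \<bullet> x)) ^ CARD('n) * ((u x)\<^sup>2 / ?R x)\<bar> \<le> \<bar>M / (x \<bullet> x)\<^sup>2\<bar>" if x: "x \<noteq> 0" "norm x < 1" for x :: "real^'n"
    proof -
      let ?N = "x \<bullet> x"
      have N: "0 < ?N" "?N < 1" using x by (simp_all add: inner_lt_1_iff)
      have b: "16 * ?N\<^sup>2 / (1 - ?N\<^sup>2)\<^sup>2 \<le> ?R x" by (rule hyp_ball_vol_ratio_bounds(1)) (use x n in auto)
      have N2: "0 < 1 - ?N\<^sup>2" "1 - ?N\<^sup>2 \<le> 1" using N by (auto simp: power_less_one_iff)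
      hence "(1 - ?N\<^sup>2)\<^sup>2 \<le> 1" "0 < (1 - ?N\<^sup>2)\<^sup>2" by (auto simp: power_le_one)
      hence "?N\<^sup>2 \<le> 16 * ?N\<^sup>2 / (1 - ?N\<^sup>2)\<^sup>2" using mult_left_mono[of "(1 - ?N\<^sup>2)\<^sup>2" 16 "?N\<^sup>2"] by (simp add: le_divide_eq mult_ac)
      hence NR: "?N\<^sup>2 \<le> ?R x" using b by linarith
      have "\<bar>(2 / (1 - ?N)) ^ CARD('n) * (u x)\<^sup>2\<bar> / ?R x \<le> M / ?N\<^sup>2"
        using M(1) M(2)[of x] NR N by (intro frac_le) auto
      moreover have "0 \<le> ?R x" by simp
      ultimately show ?thesis using M N by (simp add: abs_mult)
    qed
    thus "AE x in lborel. norm (indicator (ball 0 1) x * ((2 / (1 - x \<bullet> x)) ^ CARD('n) * ((u x)\<^sup>2 / ?R x)))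
        \<le> norm (M * (indicator (ball 0 1) x / (x \<bullet> x)\<^sup>2))"
      using AE_lborel_singleton[of "0::real^'n"] by (auto simp: indicator_def elim: eventually_mono)
  qed (rule m2)
  thus ?thesis by (simp add: hyp_vol_integrable_iff[OF m])
qed

text \<open>Off the origin the difference \<open>F\<close> of the integrands is bounded below by the
  divergence \<open>G\<close>, whose integral vanishes. The ratio enters only through 1/R \<le>
  z(z+1), and the constants are b^2 = (n-1)^4/16 and k^2 = n^2 (n-4)^2/16.\<close>

lemma hyp_rellich_inequality:
  fixes u :: "real^'n::finite \<Rightarrow> real"
  assumes u: "test_fun r u" "r < 1" and n: "CARD('n) \<ge> 5"
  shows "(real CARD('n))\<^sup>2 * (real CARD('n) - 4)\<^sup>2 / 16
            * (\<integral>x. (u x)\<^sup>2 / hyp_ball_vol_ratio x powr (4 / real CARD('n)) \<partial>hyp_vol)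
    \<le> (\<integral>x. (hyp_laplacian u x)\<^sup>2 \<partial>hyp_vol) - (real CARD('n) - 1) ^ 4 / 16 * (\<integral>x. (u x)\<^sup>2 \<partial>hyp_vol)"
proof -
  let ?n = "CARD('n)"
  let ?R = "\<lambda>x::real^'n. hyp_ball_vol_ratio x powr (4 / real ?n)"
  let ?w = "\<lambda>x::real^'n. (2 / (1 - x \<bullet> x)) ^ ?n"
  let ?I = "indicator (ball (0::real^'n) 1) :: _ \<Rightarrow> real"
  note cu = test_fun_continuous[OF u] and cl = continuous_on_hyp_laplacian[OF u]
  have c: "continuous_on UNIV (\<lambda>x. (hyp_laplacian u x)\<^sup>2)" "continuous_on UNIV (\<lambda>x. (u x)\<^sup>2)"
    by (intro continuous_intros cu cl)+
  have i: "integrable hyp_vol (\<lambda>x. (hyp_laplacian u x)\<^sup>2)" "integrable hyp_vol (\<lambda>x. (u x)\<^sup>2)"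
    by (rule hyp_vol_integrable_continuous[OF c(1) u(2)], use hyp_laplacian_zero[OF u(1)] in simp)
      (rule hyp_vol_integrable_continuous[OF c(2) u(2)], use test_fun_zero[OF u(1)] in simp)
  note m = c[THEN continuous_measurable_ball] rellich_weight_measurable[OF cu]
  note i1 = i(1)[unfolded hyp_vol_integrable_iff[OF m(1)]] and i2 = i(2)[unfolded hyp_vol_integrable_iff[OF m(2)]]
    and i3 = rellich_weight_integrable[OF u n, unfolded hyp_vol_integrable_iff[OF m(3)]]
  define F where "F x = ?I x * (?w x * (hyp_laplacian u x)\<^sup>2) - (rellich_b ?n)\<^sup>2 * (?I x * (?w x * (u x)\<^sup>2))
    - (rellich_k ?n)\<^sup>2 * (?I x * (?w x * ((u x)\<^sup>2 / ?R x)))" for x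
  have iF: "integrable lborel F" unfolding F_def
    by (intro Bochner_Integration.integrable_diff integrable_mult_right i1 i2 i3)
  have eF: "integral\<^sup>L lborel F = (\<integral>x. (hyp_laplacian u x)\<^sup>2 \<partial>hyp_vol) - (rellich_b ?n)\<^sup>2 * (\<integral>x. (u x)\<^sup>2 \<partial>hyp_vol)
    - (rellich_k ?n)\<^sup>2 * (\<integral>x. (u x)\<^sup>2 / ?R x \<partial>hyp_vol)"
    unfolding F_def hyp_vol_integral_eq[OF m(1)] hyp_vol_integral_eq[OF m(2)] hyp_vol_integral_eq[OF m(3)]
    by (simp only: Bochner_Integration.integral_diff Bochner_Integration.integrable_diff integrable_mult_right i1 i2 i3 integral_mult_right_zero)
  define G where "G x = radial_div (rellich_A ?n (x \<bullet> x) / (x \<bullet> x)) (rellich_A' ?n (x \<bullet> x) / (x \<bullet> x) - rellich_A ?n (x \<bullet> x) / (x \<bullet> x)\<^sup>2)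
      (rellich_B ?n (x \<bullet> x) / (x \<bullet> x)\<^sup>2) (rellich_B' ?n (x \<bullet> x) / (x \<bullet> x)\<^sup>2 - 2 * rellich_B ?n (x \<bullet> x) / (x \<bullet> x) ^ 3) u x" for x
  note G = integral_radial_div_singular[OF n u DERIV_rellich_A[OF n] DERIV_rellich_B[OF n] continuous_on_rellich_A' continuous_on_rellich_B', folded G_def]
  have "G x \<le> F x" if "x \<noteq> 0" for x
  proof (cases "norm x < 1")
    case False
    hence "u x = 0" "gradient u x = 0" using u test_fun_zero[OF u(1), of x] test_fun_laplacian_zero[OF u(1), of x] by auto
    thus ?thesis using False by (simp add: G_def F_def radial_div_def)
  next
    case True
    let ?N = "x \<bullet> x"
    have N: "0 < ?N" "?N < 1" using that True by (simp_all add: inner_lt_1_iff)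
    have N2: "0 < 1 - ?N\<^sup>2" using N by (auto simp: power_less_one_iff)
    have b: "16 * ?N\<^sup>2 / (1 - ?N\<^sup>2)\<^sup>2 \<le> ?R x" by (rule hyp_ball_vol_ratio_bounds(1)) (use that True n in auto)
    have "(u x)\<^sup>2 / ?R x \<le> (u x)\<^sup>2 / (16 * ?N\<^sup>2 / (1 - ?N\<^sup>2)\<^sup>2)"
      using b N N2 by (intro divide_left_mono mult_pos_pos divide_pos_pos) (use hyp_ball_vol_ratio_bounds(3)[of x] that True n in auto)
    hence "(u x)\<^sup>2 / ?R x \<le> (u x)\<^sup>2 * ((1 - ?N\<^sup>2)\<^sup>2 / (16 * ?N\<^sup>2))" by simp
    hence "?w x * ((rellich_k ?n)\<^sup>2 * ((u x)\<^sup>2 / ?R x)) \<le> ?w x * ((rellich_k ?n)\<^sup>2 * ((u x)\<^sup>2 * ((1 - ?N\<^sup>2)\<^sup>2 / (16 * ?N\<^sup>2))))"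
      using N by (intro mult_left_mono) auto
    moreover have "G x + ?w x * ((u x)\<^sup>2 * ((rellich_b ?n)\<^sup>2 + (rellich_k ?n)\<^sup>2 * ((1 - ?N\<^sup>2)\<^sup>2 / (16 * ?N\<^sup>2)))) \<le> ?w x * (hyp_laplacian u x)\<^sup>2"
      unfolding G_def by (rule rellich_radial_div[OF n refl that True])
    ultimately show ?thesis using True unfolding F_def by (simp add: algebra_simps)
  qed
  hence "AE x in lborel. G x \<le> F x"
    using AE_lborel_singleton[of "0::real^'n"] by (auto elim: eventually_mono)
  from integral_mono_AE[OF G(1) iF this] have "0 \<le> integral\<^sup>L lborel F" by (simp add: G(2))
  thus ?thesis unfolding eF by (simp add: rellich_b_def rellich_k_def power_mult_distrib power_divide flip: power_mult)
qed

section \<open>Sharpness\<close>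

text \<open>The classical function exp(-1/y), extended by zero, with a polynomial factor in 1/y so
  that the family is closed under differentiation.\<close>

definition bump :: "real poly \<Rightarrow> real \<Rightarrow> real" where
  "bump p y = (if y > 0 then poly p (1 / y) * exp (- (1 / y)) else 0)"

text \<open>With s = 1/y one has d/dy = -s^2 d/ds, which turns p(s) exp(-s) into s^2 (p(s) - p'(s))
  exp(-s); \<open>[:0, 0, 1:]\<close> is the polynomial s^2.\<close>

definition bump_deriv :: "real poly \<Rightarrow> real poly" where
  "bump_deriv p = [:0, 0, 1:] * (p - pderiv p)"

lemma poly_mult_exp_minus_tendsto_0: "((\<lambda>t. poly p t * exp (- t)) \<longlongrightarrow> (0::real)) at_top"
proof -
  have "((\<lambda>t. \<Sum>i\<le>degree p. coeff p i * (t ^ i / exp t)) \<longlongrightarrow> (\<Sum>i\<le>degree p. coeff p i * 0)) at_top"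
    by (intro tendsto_sum tendsto_mult tendsto_const tendsto_power_div_exp_0)
  thus ?thesis by (simp add: poly_altdef sum_distrib_right exp_minus divide_inverse mult.assoc)
qed

lemma bump_tendsto_0: "(bump p \<longlongrightarrow> 0) (at 0)"
proof (rule filterlim_split_at)
  have "(bump p \<longlongrightarrow> 0) (at_left 0) \<longleftrightarrow> ((\<lambda>_. 0::real) \<longlongrightarrow> 0) (at_left (0::real))"
    by (intro filterlim_cong refl) (auto simp: eventually_at_filter bump_def)
  thus "(bump p \<longlongrightarrow> 0) (at_left 0)" by simp
  have "((\<lambda>y. poly p (inverse y) * exp (- inverse y)) \<longlongrightarrow> 0) (at_right (0::real))"
    using filterlim_compose[OF poly_mult_exp_minus_tendsto_0 filterlim_inverse_at_top_right] .
  moreover have "(bump p \<longlongrightarrow> 0) (at_right 0) \<longleftrightarrow> ((\<lambda>y. poly p (inverse y) * exp (- inverse y)) \<longlongrightarrow> 0) (at_right (0::real))"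
    by (intro filterlim_cong refl) (auto simp: eventually_at_filter bump_def inverse_eq_divide)
  ultimately show "(bump p \<longlongrightarrow> 0) (at_right 0)" by simp
qed

lemma DERIV_bump: "(bump p has_real_derivative bump (bump_deriv p) y) (at y)"
proof -
  consider "y > 0" | "y < 0" | "y = 0" by linarith
  thus ?thesis
  proof cases
    case 1
    have "((\<lambda>y. poly p (1 / y) * exp (- (1 / y))) has_real_derivative bump (bump_deriv p) y) (at y)"
      using 1 by (auto intro!: derivative_eq_intros DERIV_chain2[OF poly_DERIV]
          simp: bump_def bump_deriv_def field_simps power2_eq_square)
    thus ?thesis
      by (rule has_field_derivative_transform_within_open[where S = "{0<..}"]) (use 1 in \<open>auto simp: bump_def\<close>)
  next
    case 2
    have "((\<lambda>_. 0) has_real_derivative bump (bump_deriv p) y) (at y)" using 2 by (simp add: bump_def)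
    thus ?thesis
      by (rule has_field_derivative_transform_within_open[where S = "{..<0}"]) (use 2 in \<open>auto simp: bump_def\<close>)
  next
    case 3
    \<comment> \<open>Dividing by \<open>h\<close> multiplies the polynomial by its variable 1/h, so
      the difference quotient at 0 is again a bump and tends to 0.\<close>
    have "(bump p (0 + h) - bump p 0) / h = bump ([:0, 1:] * p) h" for h by (simp add: bump_def)
    moreover have "bump (bump_deriv p) 0 = 0" by (simp add: bump_def)
    ultimately show ?thesis using bump_tendsto_0[of "[:0, 1:] * p"] 3 by (simp add: DERIV_def)
  qed
qed

lemma continuous_on_bump: "continuous_on S (bump p)"
  using DERIV_bump DERIV_isCont by (blast intro: continuous_at_imp_continuous_on)

lemma bump_bounded:
  obtains K where "K \<ge> 0" "\<And>y. y \<le> h \<Longrightarrow> \<bar>bump p y\<bar> \<le> K"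
proof -
  have "bounded (bump p ` {0..h})"
    by (intro compact_imp_bounded compact_continuous_image continuous_on_bump) auto
  then obtain K where K: "\<forall>y\<in>{0..h}. \<bar>bump p y\<bar> \<le> K" unfolding bounded_iff by auto
  have "\<bar>bump p y\<bar> \<le> max K 0" if "y \<le> h" for y
  proof (cases "y \<ge> 0")
    case True thus ?thesis using K that by (auto simp: max_def; force)
  qed (simp add: bump_def)
  thus ?thesis using that[of "max K 0"] by simp
qed

text \<open>A family of functions containing the near-extremal functions and closed under partial
  derivatives.\<close>

inductive_set smooth_family :: "real \<Rightarrow> real \<Rightarrow> (real^'n::finite \<Rightarrow> real) set" for e h where
  const: "(\<lambda>_. c) \<in> smooth_family e h"
| coord: "(\<lambda>x. x $ i) \<in> smooth_family e h"
| powr: "(\<lambda>x. (x \<bullet> x + e) powr c) \<in> smooth_family e h"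
| bump: "(\<lambda>x. bump p (h - x \<bullet> x)) \<in> smooth_family e h"
| add: "f \<in> smooth_family e h \<Longrightarrow> g \<in> smooth_family e h \<Longrightarrow> (\<lambda>x. f x + g x) \<in> smooth_family e h"
| mult: "f \<in> smooth_family e h \<Longrightarrow> g \<in> smooth_family e h \<Longrightarrow> (\<lambda>x. f x * g x) \<in> smooth_family e h"

lemma differentiable_comp_norm_square:
  fixes x :: "'a::real_inner"
  assumes "(h has_real_derivative d) (at (x \<bullet> x))"
  shows "(\<lambda>x. h (x \<bullet> x)) differentiable (at x)"
proof -
  have "(\<lambda>x. x \<bullet> x) differentiable (at x)"     unfolding differentiable_def using has_derivative_inner[OF has_derivative_ident has_derivative_ident] by blast
  moreover have "h differentiable (at (x \<bullet> x))" using assms real_differentiable_def by blast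
  ultimately show ?thesis using differentiable_chain_at[of "\<lambda>x. x \<bullet> x" x h] by (simp add: o_def)
qed

lemma smooth_family_partial_deriv:
  fixes f :: "real^'n::finite \<Rightarrow> real"
  assumes "f \<in> smooth_family e h" "e > 0"
  shows "(\<forall>x. f differentiable (at x)) \<and> (\<forall>i. partial_deriv i f \<in> smooth_family e h)"
  using assms(1)
proof induction
  case (const c)
  have "partial_deriv i (\<lambda>_::real^'n. c) = (\<lambda>_. 0)" for i by (intro ext partial_deriv_eq) simp
  thus ?case using smooth_family.const by auto
next
  case (coord j)
  have "partial_deriv i (\<lambda>x::real^'n. x $ j) = (\<lambda>_. axis i 1 $ j)" for i
    by (intro ext partial_deriv_eq) (auto intro!: derivative_eq_intros)
  thus ?case using smooth_family.const by (auto simp: bounded_linear_vec_nth intro: bounded_linear_imp_differentiable)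
next
  case (powr c)
  have d: "((\<lambda>t. (t + e) powr c) has_real_derivative c * (x \<bullet> x + e) powr (c - 1)) (at (x \<bullet> x))" for x :: "real^'n"
    using assms(2) by (auto intro!: derivative_eq_intros simp: add_nonneg_pos)
  have "partial_deriv i (\<lambda>x::real^'n. (x \<bullet> x + e) powr c) = (\<lambda>x. (c * (x \<bullet> x + e) powr (c - 1)) * (2 * x $ i))" for i
    by (intro ext partial_deriv_eq DERIV_comp_norm_square_line[OF d])
  moreover have "(\<lambda>x::real^'n. (c * (x \<bullet> x + e) powr (c - 1)) * (2 * x $ i)) \<in> smooth_family e h" for i
    by (intro smooth_family.intros)
  ultimately show ?case using differentiable_comp_norm_square[OF d] by auto
next
  case (bump p)
  have d: "((\<lambda>t. bump p (h - t)) has_real_derivative (- 1) * bump (bump_deriv p) (h - x \<bullet> x)) (at (x \<bullet> x))" for x :: "real^'n"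
  proof -
    have "((\<lambda>t. h - t) has_real_derivative - 1) (at (x \<bullet> x))" by (auto intro!: derivative_eq_intros)
    from DERIV_chain2[OF DERIV_bump this] show ?thesis by simp
  qed
  have "partial_deriv i (\<lambda>x::real^'n. bump p (h - x \<bullet> x)) = (\<lambda>x. ((- 1) * bump (bump_deriv p) (h - x \<bullet> x)) * (2 * x $ i))" for i
    by (intro ext partial_deriv_eq DERIV_comp_norm_square_line[OF d])
  moreover have "(\<lambda>x::real^'n. ((- 1) * bump (bump_deriv p) (h - x \<bullet> x)) * (2 * x $ i)) \<in> smooth_family e h" for i
    by (intro smooth_family.intros)
  ultimately show ?case using differentiable_comp_norm_square[OF d] by auto
next
  case (add f g)
  have "partial_deriv i (\<lambda>x. f x + g x) = (\<lambda>x. partial_deriv i f x + partial_deriv i g x)" for i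
    using add by (intro ext partial_deriv_eq DERIV_add has_partial_deriv) auto
  thus ?case using add by (auto intro!: smooth_family.intros)
next
  case (mult f g)
  have "partial_deriv i (\<lambda>x. f x * g x) = (\<lambda>x. partial_deriv i f x * g x + partial_deriv i g x * f x)" for i
  proof (intro ext partial_deriv_eq)
    fix x show "((\<lambda>t. f (x + t *\<^sub>R axis i 1) * g (x + t *\<^sub>R axis i 1)) has_real_derivative
      partial_deriv i f x * g x + partial_deriv i g x * f x) (at 0)"
      using DERIV_mult[OF has_partial_deriv[of f x i] has_partial_deriv[of g x i]] mult by auto
  qed
  thus ?case using mult by (auto intro!: smooth_family.intros)
qed

lemma smooth_family_smooth_on:
  assumes "f \<in> smooth_family e h" "e > 0"
  shows "smooth_on S f"
proof -
  have "Ck_on k S f" if "f \<in> smooth_family e h" for k f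
    using that
  proof (induction k arbitrary: f)
    case 0
    have "isCont f x" for x
      using smooth_family_partial_deriv[OF 0 assms(2)] differentiable_imp_continuous_within by blast
    thus ?case by (simp add: continuous_at_imp_continuous_on)
  next
    case (Suc k)
    thus ?case using smooth_family_partial_deriv[OF Suc.prems assms(2)] by simp
  qed
  thus ?thesis using assms(1) unfolding smooth_on_def by blast
qed

section \<open>Near-extremal functions\<close>

lemma test_fun_hyp_test_function:
  assumes "test_fun r u" "r < 1"
  shows "u \<in> hyp_test_functions"
proof -
  have sub: "closure {x. u x \<noteq> 0} \<subseteq> cball 0 r"
    by (rule closure_minimal) (use test_fun_zero[OF assms(1)] in \<open>auto simp: not_less[symmetric]\<close>)
  moreover have "cball 0 r \<subseteq> ball 0 1" using assms by auto
  moreover have "compact (closure {x. u x \<noteq> 0})"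
    using sub bounded_subset[OF bounded_cball] by (auto simp: compact_eq_bounded_closed)
  ultimately show ?thesis using assms(1) unfolding hyp_test_functions_def test_fun_def by blast
qed

lemma hyp_laplacian_radial:
  fixes x :: "real^'n::finite"
  assumes H: "\<And>t. 0 \<le> t \<Longrightarrow> (H has_real_derivative H' t) (at t)"
    and H': "\<And>t. 0 \<le> t \<Longrightarrow> (H' has_real_derivative H'' t) (at t)"
  defines "N \<equiv> x \<bullet> x"
  shows "hyp_laplacian (\<lambda>x. H (x \<bullet> x)) x = ((1 - N) / 2)\<^sup>2 * (4 * N * H'' N + 2 * real CARD('n) * H' N)
     + (real CARD('n) - 2) * ((1 - N) / 2) * (2 * N * H' N)"
proof -
  have p: "partial_deriv i (\<lambda>x::real^'n. H (x \<bullet> x)) = (\<lambda>x. H' (x \<bullet> x) * (2 * x $ i))" for i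
    by (intro ext partial_deriv_eq DERIV_comp_norm_square_line H) simp
  have pp: "partial_deriv i (\<lambda>x. H' (x \<bullet> x) * (2 * x $ i)) x = 4 * H'' N * (x $ i * x $ i) + 2 * H' N" for i
    unfolding N_def
    by (rule partial_deriv_eq, rule DERIV_cong[OF DERIV_mult[OF DERIV_comp_norm_square_line[OF H'] DERIV_cmult[OF DERIV_component_line]]])
      (simp_all add: algebra_simps)
  have l: "laplacian (\<lambda>x. H (x \<bullet> x)) x = 4 * N * H'' N + 2 * real CARD('n) * H' N"
    unfolding laplacian_def p pp N_def by (simp add: sum.distrib sum_partials(1) flip: sum_distrib_left)
  have "gradient (\<lambda>x. H (x \<bullet> x)) x $ i = H' N * (2 * x $ i)" for i
    by (simp add: gradient_def p N_def)
  hence "x \<bullet> gradient (\<lambda>x. H (x \<bullet> x)) x = (\<Sum>i\<in>UNIV. 2 * H' N * (x $ i * x $ i))"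
    unfolding inner_vec_def[of x "gradient _ _"] by (intro sum.cong) simp_all
  also have "\<dots> = 2 * N * H' N" by (simp add: N_def sum_partials(1) flip: sum_distrib_left)
  finally show ?thesis unfolding hyp_laplacian_def l power2_norm_eq_inner N_def[symmetric] by simp
qed

text \<open>Here \<open>U = (t + \<epsilon>)\<^sup>-\<^sup>b\<close>, \<open>s = t/(t + \<epsilon>)\<close>, and \<open>H1\<close>, \<open>H2\<close> are the first two derivatives of
  \<open>U f\<close>. The leading term is \<open>U f \<kappa> (2s - s\<^sup>2)\<close>, and \<open>2s - s\<^sup>2 \<le> 1\<close>.\<close>

lemma near_extremal_laplacian_bound:
  fixes n t s U f f1 f2 K :: real
  assumes n: "n \<ge> 5" and t: "0 < t" "t < 1" and s: "0 < s" "s < 1" and U: "0 \<le> U"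
    and f: "0 \<le> f" "\<bar>f1\<bar> \<le> K" "\<bar>f2\<bar> \<le> K"
  defines "b \<equiv> (n - 4) / 4" and "k \<equiv> n * (n - 4) / 4"
  defines "H1 \<equiv> - b * U * (s / t) * f + U * f1"
    and "H2 \<equiv> b * (b + 1) * U * (s / t)\<^sup>2 * f + 2 * (- b * U * (s / t)) * f1 + U * f2"
  shows "t * \<bar>((1 - t) / 2)\<^sup>2 * (4 * t * H2 + 2 * n * H1) + (n - 2) * ((1 - t) / 2) * (2 * t * H1)\<bar>
    \<le> U * (f * k + 4 * ((8 * b + 4 + 2 * n) * K / 4 + (n - 2) * (b * f + K)) * t) / 4"
proof -
  have b: "b > 0" and k: "k = n * b" "k > 0" using n by (auto simp: b_def k_def)
  have n4: "n = 4 * (b + 1)" by (simp add: b_def field_simps)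
  have K: "K \<ge> 0" using f by linarith
  have s2: "0 \<le> 2 * s - s\<^sup>2" "2 * s - s\<^sup>2 \<le> 1"
    using s zero_le_power2[of "1 - s"] by (auto simp: power2_eq_square algebra_simps mult_le_one intro: order.trans[of _ s])
  \<comment> \<open>\<open>X\<close> and \<open>Y\<close> are t times the Euclidean Laplacian and t
    times the radial term. The factor t turns every s/t into s and so removes the
    singularity.\<close>
  define X where "X = t * (4 * t * H2 + 2 * n * H1)"
  define Y where "Y = t * (2 * t * H1)"
  \<comment> \<open>Because 4(b+1) = n, the contributions k s^2 from \<open>H2\<close> and -2 k s
    from \<open>H1\<close> combine to -k (2s - s^2); everything involving \<open>f1\<close> or
    \<open>f2\<close> carries an extra factor t.\<close>
  have X: "X = - (U * f * k * (2 * s - s\<^sup>2)) + t * (U * (- 8 * b * s * f1 + 4 * t * f2 + 2 * n * f1))"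
    unfolding X_def H1_def H2_def k(1) n4 using t by (simp add: field_simps power2_eq_square)
  have bs: "\<bar>b * s * f1\<bar> \<le> b * K"
  proof -
    have "b * s * \<bar>f1\<bar> \<le> b * 1 * K" using b s f K by (intro mult_mono) auto
    thus ?thesis using b s by (simp add: abs_mult)
  qed
  have tf: "\<bar>t * f2\<bar> \<le> K"
  proof -
    have "t * \<bar>f2\<bar> \<le> 1 * K" using t f K by (intro mult_mono) auto
    thus ?thesis using t by (simp add: abs_mult)
  qed
  have nf: "\<bar>n * f1\<bar> \<le> n * K" using n f by (simp add: abs_mult mult_left_mono)
  have "\<bar>- 8 * b * s * f1 + 4 * t * f2 + 2 * n * f1\<bar> \<le> (8 * b + 4 + 2 * n) * K"
    using bs tf nf by (simp add: algebra_simps abs_le_iff)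
  hence 1: "t * (U * \<bar>- 8 * b * s * f1 + 4 * t * f2 + 2 * n * f1\<bar>) \<le> t * (U * ((8 * b + 4 + 2 * n) * K))"
    using t U by (intro mult_left_mono) auto
  have 2: "U * f * k * (2 * s - s\<^sup>2) \<le> U * f * k" using mult_left_mono[OF s2(2), of "U * f * k"] U f k by simp
  have "\<bar>X\<bar> \<le> \<bar>U * f * k * (2 * s - s\<^sup>2)\<bar> + \<bar>t * (U * (- 8 * b * s * f1 + 4 * t * f2 + 2 * n * f1))\<bar>"
    unfolding X by linarith
  also have "\<dots> = U * f * k * (2 * s - s\<^sup>2) + t * (U * \<bar>- 8 * b * s * f1 + 4 * t * f2 + 2 * n * f1\<bar>)"
  proof -
    have "0 \<le> U * f * k * (2 * s - s\<^sup>2)" using U f k(2) s2 by (intro mult_nonneg_nonneg) auto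
    from abs_of_nonneg[OF this] show ?thesis using U t by (simp only:) (simp add: abs_mult)
  qed
  also have "\<dots> \<le> U * f * k + t * (U * ((8 * b + 4 + 2 * n) * K))" using 1 2 by linarith
  finally have X1: "\<bar>X\<bar> \<le> U * f * k + t * (U * ((8 * b + 4 + 2 * n) * K))" .
  have Y: "Y = 2 * t * (U * (- (b * s * f) + t * f1))"
    unfolding Y_def H1_def using t by (simp add: field_simps power2_eq_square)
  have "\<bar>- (b * s * f) + t * f1\<bar> \<le> b * f + K"
  proof -
    have "b * s * f \<le> b * 1 * f" using b s f by (intro mult_mono) auto
    moreover have "\<bar>t * f1\<bar> \<le> K" using mult_mono[of t 1 "\<bar>f1\<bar>" K] t f K by (simp add: abs_mult)
    moreover have "0 \<le> b * s * f" using b s f by simp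
    ultimately show ?thesis by linarith
  qed
  hence Y1: "\<bar>Y\<bar> \<le> 2 * t * (U * (b * f + K))"
    unfolding Y abs_mult using t U by (simp add: mult_left_mono)
  have "t * \<bar>((1 - t) / 2)\<^sup>2 * (4 * t * H2 + 2 * n * H1) + (n - 2) * ((1 - t) / 2) * (2 * t * H1)\<bar>
    = \<bar>((1 - t) / 2)\<^sup>2 * X + (n - 2) * ((1 - t) / 2) * Y\<bar>"
    using abs_mult_pos[of t "((1 - t) / 2)\<^sup>2 * (4 * t * H2 + 2 * n * H1) + (n - 2) * ((1 - t) / 2) * (2 * t * H1)"] t
    unfolding X_def Y_def by (simp add: algebra_simps)
  also have "\<dots> \<le> ((1 - t) / 2)\<^sup>2 * \<bar>X\<bar> + (n - 2) * ((1 - t) / 2) * \<bar>Y\<bar>"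
    using abs_triangle_ineq[of "((1 - t) / 2)\<^sup>2 * X" "(n - 2) * ((1 - t) / 2) * Y"] n t by (simp add: abs_mult)
  also have "\<dots> \<le> (1 / 4) * \<bar>X\<bar> + (n - 2) * (1 / 2) * \<bar>Y\<bar>"
  proof (intro add_mono mult_right_mono mult_left_mono)
    have "((1 - t) / 2)\<^sup>2 \<le> (1 / 2)\<^sup>2" using t by (intro power_mono) auto
    thus "((1 - t) / 2)\<^sup>2 \<le> 1 / 4" by (simp add: power_divide)
  qed (use n t in auto)
  also have "\<dots> \<le> (1 / 4) * (U * f * k + t * (U * ((8 * b + 4 + 2 * n) * K))) + (n - 2) * (1 / 2) * (2 * t * (U * (b * f + K)))"
    using X1 Y1 n by (intro add_mono mult_left_mono) auto
  also have "\<dots> = U * (f * k + 4 * ((8 * b + 4 + 2 * n) * K / 4 + (n - 2) * (b * f + K)) * t) / 4"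
    by (simp add: field_simps)
  finally show ?thesis .
qed

text \<open>The difference \<open>F\<close> of the integrands is at most \<open>G\<close>, a bounded
  term minus a multiple of the critical integrand \<open>J\<close>. The integral of \<open>J\<close>
  can be made arbitrarily large by the choice of \<epsilon>, while the bounded term does not depend
  on it.\<close>

lemma hyp_rellich_sharp:
  fixes C0 :: real
  assumes n: "CARD('n::finite) \<ge> 5" and C0: "C0 > (real CARD('n))\<^sup>2 * (real CARD('n) - 4)\<^sup>2 / 16"
  shows "\<exists>u \<in> (hyp_test_functions :: (real^'n \<Rightarrow> real) set).
    (\<integral>x. (hyp_laplacian u x)\<^sup>2 \<partial>hyp_vol)
      < C0 * (\<integral>x. (u x)\<^sup>2 / hyp_ball_vol_ratio x powr (4 / real CARD('n)) \<partial>hyp_vol)"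
proof -
  let ?n = "CARD('n)"
  let ?R = "\<lambda>x::real^'n. hyp_ball_vol_ratio x powr (4 / real ?n)"
  let ?w = "\<lambda>x::real^'n. (2 / (1 - x \<bullet> x)) ^ ?n"
  let ?I = "indicator (ball (0::real^'n) 1) :: _ \<Rightarrow> real"
  \<comment> \<open>This exponent is critical: the square of (t+e)^(-b), divided by (t+e)^2, is
    (t+e)^(-n/2).\<close>
  define b where "b = (real ?n - 4) / 4"
  define k where "k = real ?n * (real ?n - 4) / 4"
  define f where "f t = bump 1 (1/2 - t)" for t
  define f1 where "f1 t = - bump (bump_deriv 1) (1/2 - t)" for t
  define f2 where "f2 t = bump (bump_deriv (bump_deriv 1)) (1/2 - t)" for t
  have n5: "real ?n \<ge> 5" using n by simp
  have b: "b > 0" and k: "k > 0" using n5 by (auto simp: b_def k_def)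
  have C0k: "C0 > k\<^sup>2" using C0 by (simp add: k_def power_mult_distrib power_divide)
  have C0p: "C0 > 0" using C0k zero_le_power2[of k] by linarith
  obtain K0 where K0: "K0 \<ge> 0" "\<And>y. y \<le> 1/2 \<Longrightarrow> \<bar>bump 1 y\<bar> \<le> K0" using bump_bounded by blast
  obtain K1 where K1: "K1 \<ge> 0" "\<And>y. y \<le> 1/2 \<Longrightarrow> \<bar>bump (bump_deriv 1) y\<bar> \<le> K1" using bump_bounded by blast
  obtain K2 where K2: "K2 \<ge> 0" "\<And>y. y \<le> 1/2 \<Longrightarrow> \<bar>bump (bump_deriv (bump_deriv 1)) y\<bar> \<le> K2" using bump_bounded by blast
  define K where "K = K0 + K1 + K2"
  have K: "K \<ge> 0" using K0 K1 K2 by (simp add: K_def)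
  have f_nonneg: "0 \<le> f t" for t by (simp add: f_def bump_def)
  have fK: "f t \<le> K" "\<bar>f1 t\<bar> \<le> K" "\<bar>f2 t\<bar> \<le> K" if "0 \<le> t" for t
    using K0(1) K1(1) K2(1) K0(2)[of "1/2 - t"] K1(2)[of "1/2 - t"] K2(2)[of "1/2 - t"] that
    by (auto simp: f_def f1_def f2_def K_def)
  have Df: "(f has_real_derivative f1 t) (at t)" for t
  proof -
    have "((\<lambda>t. 1/2 - t) has_real_derivative - 1) (at t)" by (auto intro!: derivative_eq_intros)
    from DERIV_chain2[OF DERIV_bump[of 1] this] show ?thesis unfolding f_def[abs_def] f1_def by simp
  qed
  have Df1: "(f1 has_real_derivative f2 t) (at t)" for t
  proof -
    have "((\<lambda>t. 1/2 - t) has_real_derivative - 1) (at t)" by (auto intro!: derivative_eq_intros)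
    from DERIV_minus[OF DERIV_chain2[OF DERIV_bump[of "bump_deriv 1"] this]]
    show ?thesis unfolding f1_def[abs_def] f2_def by simp
  qed
  \<comment> \<open>The error constant of \<open>near_extremal_laplacian_bound\<close> with the
    value of \<open>f\<close> replaced by its bound \<open>K\<close>, so that it no longer depends
    on the point.\<close>
  define C where "C = (8 * b + 4 + 2 * real ?n) * K / 4 + (real ?n - 2) * (b * K + K)"
  have C: "C \<ge> 0" using b K n5 unfolding C_def by (intro add_nonneg_nonneg mult_nonneg_nonneg divide_nonneg_nonneg) auto
  \<comment> \<open>For 0 < t \<le> 1/2, the quantity \<psi>(t) U^2/(16 t^2) bounds C0 u^2/R -
    (\<Delta>\<open>\<^sub>g\<close>u)^2 from below. At 0 it reduces to (C0 - k^2) f(0)^2 > 0, so by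
    continuity it stays above half that value for small t.\<close>
  define \<psi> where "\<psi> t = C0 * (f t)\<^sup>2 * (1 - t) ^ 4 - (f t * k + 4 * C * t)\<^sup>2" for t
  define \<delta> where "\<delta> = \<psi> 0 / 2"
  have f0: "f 0 > 0" by (simp add: f_def bump_def)
  have "\<psi> 0 = (C0 - k\<^sup>2) * (f 0)\<^sup>2" by (simp add: \<psi>_def power_mult_distrib algebra_simps)
  hence \<delta>: "\<delta> > 0" "\<delta> < \<psi> 0" using C0k f0 by (simp_all add: \<delta>_def)
  have "isCont f 0" using Df DERIV_isCont by blast
  hence "isCont \<psi> 0" unfolding \<psi>_def[abs_def] by (intro continuous_intros)
  hence "(\<psi> \<longlongrightarrow> \<psi> 0) (at 0)" by (simp add: isCont_def)
  hence "eventually (\<lambda>t. \<delta> < \<psi> t) (at 0)" using \<delta>(2) by (rule order_tendstoD)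
  then obtain d where d: "d > 0" "\<And>t. t \<noteq> 0 \<Longrightarrow> dist t 0 < d \<Longrightarrow> \<delta> < \<psi> t" by (auto simp: eventually_at)
  define t0 where "t0 = min d (1/2)"
  have t0: "0 < t0" "t0 \<le> 1/2" "\<And>t. 0 < t \<Longrightarrow> t < t0 \<Longrightarrow> \<delta> < \<psi> t" using d by (auto simp: t0_def)
  \<comment> \<open>A bound for \<open>F\<close> where t0 \<le> t \<le> 1/2. It is uniform in
    \<open>e\<close>, which is why \<open>e\<close> may be chosen after it.\<close>
  define M where "M = 4 ^ ?n * (t0 powr (- (2 * b) - 2) * ((K * k + 4 * C) / 4)\<^sup>2)"
  have M: "M \<ge> 0" unfolding M_def by (intro mult_nonneg_nonneg) auto
  define vol where "vol = measure lborel (ball (0::real^'n) 1)"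
  obtain e where e: "0 < e" "e \<le> 1"
    "16 * M * vol / \<delta> < (\<integral>x. indicator (ball (0::real^'n) (sqrt t0)) x * (x \<bullet> x + e) powr (- real ?n / 2) \<partial>lborel)"
    using integral_regularized_norm_power_unbounded[of "sqrt t0" "16 * M * vol / \<delta>", where ?'a = "real^'n"] t0(1) by auto
  define H where "H t = (t + e) powr (- b) * f t" for t
  define H1 where "H1 t = - b * (t + e) powr (- b - 1) * f t + (t + e) powr (- b) * f1 t" for t
  define H2 where "H2 t = b * (b + 1) * (t + e) powr (- b - 2) * f t + 2 * (- b * (t + e) powr (- b - 1)) * f1 t
    + (t + e) powr (- b) * f2 t" for t
  define u where "u x = H (x \<bullet> x)" for x :: "real^'n"
  have Dp: "((\<lambda>t. (t + e) powr c) has_real_derivative c * (t + e) powr (c - 1)) (at t)" if "0 \<le> t" for t c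
    using that e(1) by (auto intro!: derivative_eq_intros)
  have DH: "(H has_real_derivative H1 t) (at t)" if "0 \<le> t" for t
    unfolding H_def[abs_def] H1_def
    by (rule DERIV_cong[OF DERIV_mult[OF Dp[OF that, of "- b"] Df]]) (simp add: algebra_simps)
  have DH1: "(H1 has_real_derivative H2 t) (at t)" if "0 \<le> t" for t
    unfolding H1_def[abs_def] H2_def
    by (rule DERIV_cong[OF DERIV_add[OF DERIV_mult[OF DERIV_cmult[OF Dp[OF that, of "- b - 1"], of "- b"] Df] DERIV_mult[OF Dp[OF that, of "- b"] Df1]]])
      (simp add: algebra_simps)
  define r where "r = sqrt (1/2::real)"
  have r: "r < 1" by (simp add: r_def real_sqrt_lt_1_iff)
  have r2: "x \<bullet> x > 1/2" if "norm x > r" for x :: "real^'n"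
    using that unfolding r_def by (simp add: norm_eq_sqrt_inner)
  have tu: "test_fun r u"
    unfolding test_fun_def
  proof (intro conjI allI impI)
    have "u \<in> smooth_family e (1/2)"
      unfolding u_def[abs_def] H_def f_def by (intro smooth_family.intros)
    thus "smooth_on (ball 0 1) u" using e(1) by (rule smooth_family_smooth_on)
    show "u x = 0" if "norm x > r" for x
      using r2[OF that] by (simp add: u_def H_def f_def bump_def)
  qed
  have cu: "continuous_on UNIV u" and cl: "continuous_on UNIV (hyp_laplacian u)"
    by (rule test_fun_continuous[OF tu r] continuous_on_hyp_laplacian[OF tu r])+
  have c: "continuous_on UNIV (\<lambda>x. (hyp_laplacian u x)\<^sup>2)" by (intro continuous_intros cl)
  have i: "integrable hyp_vol (\<lambda>x. (hyp_laplacian u x)\<^sup>2)"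
    by (rule hyp_vol_integrable_continuous[OF c r]) (simp add: hyp_laplacian_zero[OF tu])
  note m1 = continuous_measurable_ball[OF c] and m2 = rellich_weight_measurable[OF cu]
  note i1 = i[unfolded hyp_vol_integrable_iff[OF m1]] and i2 = rellich_weight_integrable[OF tu r n, unfolded hyp_vol_integrable_iff[OF m2]]
  define F where "F x = ?I x * (?w x * (hyp_laplacian u x)\<^sup>2) - C0 * (?I x * (?w x * ((u x)\<^sup>2 / ?R x)))" for x
  have iF: "integrable lborel F" unfolding F_def
    by (intro Bochner_Integration.integrable_diff integrable_mult_right i1 i2)
  have eF: "integral\<^sup>L lborel F = (\<integral>x. (hyp_laplacian u x)\<^sup>2 \<partial>hyp_vol) - C0 * (\<integral>x. (u x)\<^sup>2 / ?R x \<partial>hyp_vol)"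
    unfolding F_def hyp_vol_integral_eq[OF m1] hyp_vol_integral_eq[OF m2]
    by (simp only: Bochner_Integration.integral_diff integrable_mult_right i1 i2 integral_mult_right_zero)
  define J where "J x = indicator (ball (0::real^'n) (sqrt t0)) x * (x \<bullet> x + e) powr (- real ?n / 2)" for x
  have iJ: "integrable lborel J"
    unfolding J_def by (rule integrable_regularized_norm_power) (use e(1) in auto)
  \<comment> \<open>The critical term acts where t < t0, and \<open>M\<close> bounds what is left.
    By the choice of \<open>e\<close> the integral of \<delta>/16 times \<open>J\<close> exceeds
    \<open>M * vol\<close>.\<close>
  define G where "G x = M * ?I x - \<delta> / 16 * J x" for x
  have iI: "integrable lborel ?I"
    by (intro integrable_real_indicator) (auto intro: emeasure_bounded_finite simp flip: infinity_ennreal_def)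
  have iG: "integrable lborel G" unfolding G_def by (intro Bochner_Integration.integrable_diff integrable_mult_right iI iJ)
  have "integral\<^sup>L lborel G = M * vol - \<delta> / 16 * integral\<^sup>L lborel J"
    unfolding G_def using iI iJ by (simp add: vol_def)
  moreover have "16 * M * vol / \<delta> < integral\<^sup>L lborel J" using e(3) unfolding J_def[abs_def] .
  hence "\<delta> / 16 * (16 * M * vol / \<delta>) < \<delta> / 16 * integral\<^sup>L lborel J" using \<delta>(1) by (intro mult_strict_left_mono) auto
  ultimately have Gneg: "integral\<^sup>L lborel G < 0" using \<delta>(1) by simp
  have FG: "F x \<le> G x" if x0: "x \<noteq> 0" for x
  proof (cases "x \<bullet> x \<le> 1/2")
    case False
    have nx: "norm x > r" using False unfolding r_def norm_eq_sqrt_inner by simp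
    have "\<not> x \<bullet> x < t0" using False t0(2) by simp
    hence "J x = 0" by (simp add: J_def norm_eq_sqrt_inner)
    thus ?thesis using test_fun_zero[OF tu nx] hyp_laplacian_zero[OF tu nx] M
      by (simp add: F_def G_def)
  next
    case True
    define t where "t = x \<bullet> x"
    have t: "0 < t" "t \<le> 1/2" "t < 1" using True x0 by (auto simp: t_def)
    have nx: "norm x < 1" using t(3) by (simp add: t_def inner_lt_1_iff)
    define U where "U = (t + e) powr (- b)"
    have U: "U > 0" using t e by (simp add: U_def)
    define s where "s = t / (t + e)"
    have s: "0 < s" "s < 1" using t e by (auto simp: s_def)
    have te: "t + e > 0" using t e by simp
    have p1: "(t + e) powr (- b - 1) = U * (s / t)" using te t by (simp add: U_def s_def powr_diff)
    have p2: "(t + e) powr (- b - 2) = U * (s / t)\<^sup>2" using te t by (simp add: U_def s_def powr_diff power_divide)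
    have H1: "H1 t = - b * U * (s / t) * f t + U * f1 t" unfolding H1_def p1 U_def[symmetric] by simp
    have H2: "H2 t = b * (b + 1) * U * (s / t)\<^sup>2 * f t + 2 * (- b * U * (s / t)) * f1 t + U * f2 t"
      unfolding H2_def p1 p2 U_def[symmetric] by simp
    have hl: "hyp_laplacian u x = ((1 - t) / 2)\<^sup>2 * (4 * t * H2 t + 2 * real ?n * H1 t) + (real ?n - 2) * ((1 - t) / 2) * (2 * t * H1 t)"
      unfolding u_def[abs_def] t_def by (rule hyp_laplacian_radial[OF DH DH1])
    have "t * \<bar>hyp_laplacian u x\<bar> \<le> U * (f t * k + 4 * ((8 * b + 4 + 2 * real ?n) * K / 4 + (real ?n - 2) * (b * f t + K)) * t) / 4"
      unfolding hl H1 H2 b_def k_def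
      by (rule near_extremal_laplacian_bound[OF n5 t(1,3) s]) (use U f_nonneg fK[of t] t in auto)
    also have "\<dots> \<le> U * (f t * k + 4 * C * t) / 4"
      unfolding C_def using U t b n5 fK(1)[of t]
      by (intro divide_right_mono mult_left_mono add_left_mono mult_right_mono) auto
    finally have hb: "t * \<bar>hyp_laplacian u x\<bar> \<le> U * (f t * k + 4 * C * t) / 4" .
    have "(t * \<bar>hyp_laplacian u x\<bar>)\<^sup>2 \<le> (U * (f t * k + 4 * C * t) / 4)\<^sup>2" using hb t by (intro power_mono) auto
    hence "t\<^sup>2 * (hyp_laplacian u x)\<^sup>2 \<le> U\<^sup>2 * (f t * k + 4 * C * t)\<^sup>2 / 16" by (simp add: power_mult_distrib power_divide)
    hence hl2: "(hyp_laplacian u x)\<^sup>2 \<le> U\<^sup>2 * (f t * k + 4 * C * t)\<^sup>2 / (16 * t\<^sup>2)" using t by (simp add: field_simps)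
    have tm2: "t powr (- 2) = 1 / t\<^sup>2"
    proof -
      have "t powr (- 2) = inverse (t powr 2)" by (rule powr_minus)
      thus ?thesis using t(1) by (simp add: inverse_eq_divide)
    qed
    have U2: "U\<^sup>2 = (t + e) powr (- (2 * b))"
      unfolding U_def power2_eq_square powr_add[symmetric] by simp
    have w1: "1 \<le> ?w x" "?w x \<le> 4 ^ ?n"
    proof -
      have "1 \<le> 2 / (1 - t)" using t by (simp add: field_simps)
      thus "1 \<le> ?w x" unfolding t_def[symmetric] by (rule one_le_power)
      have "2 / (1 - t) \<le> 4" "0 \<le> 2 / (1 - t)" using t by (simp_all add: field_simps)
      thus "?w x \<le> 4 ^ ?n" unfolding t_def[symmetric] by (intro power_mono)
    qed
    have R: "0 < ?R x" "?R x \<le> 16 * t\<^sup>2 / (1 - t) ^ 4"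
      unfolding t_def by (rule hyp_ball_vol_ratio_bounds(3) hyp_ball_vol_ratio_bounds(2); use x0 nx n in auto)+
    have ux: "u x = U * f t" by (simp add: u_def H_def U_def t_def)
    have FI: "F x = ?w x * ((hyp_laplacian u x)\<^sup>2 - C0 * ((u x)\<^sup>2 / ?R x))" using nx by (simp add: F_def algebra_simps)
    show ?thesis
    proof (cases "t < t0")
      case True
      have "(u x)\<^sup>2 / (16 * t\<^sup>2 / (1 - t) ^ 4) \<le> (u x)\<^sup>2 / ?R x" using R by (intro divide_left_mono) (use t in auto)
      hence "C0 * ((u x)\<^sup>2 / (16 * t\<^sup>2 / (1 - t) ^ 4)) \<le> C0 * ((u x)\<^sup>2 / ?R x)" using C0p by (intro mult_left_mono) auto
      moreover have "C0 * ((u x)\<^sup>2 / (16 * t\<^sup>2 / (1 - t) ^ 4)) = U\<^sup>2 * (C0 * (f t)\<^sup>2 * (1 - t) ^ 4) / (16 * t\<^sup>2)"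
        by (simp add: ux power_mult_distrib mult_ac)
      ultimately have "(hyp_laplacian u x)\<^sup>2 - C0 * ((u x)\<^sup>2 / ?R x)
          \<le> U\<^sup>2 * (f t * k + 4 * C * t)\<^sup>2 / (16 * t\<^sup>2) - U\<^sup>2 * (C0 * (f t)\<^sup>2 * (1 - t) ^ 4) / (16 * t\<^sup>2)"
        using hl2 by linarith
      also have "\<dots> = - (U\<^sup>2 / (16 * t\<^sup>2)) * \<psi> t" unfolding \<psi>_def by (simp add: algebra_simps diff_divide_distrib add_divide_distrib)
      also have "\<dots> \<le> - (U\<^sup>2 / (16 * t\<^sup>2)) * \<delta>" using t0(3)[OF t(1) True] by (intro mult_left_mono_neg) auto
      also have "\<dots> \<le> - (\<delta> / 16 * (t + e) powr (- real ?n / 2))"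
      proof -
        have "(t + e) powr (- real ?n / 2) = U\<^sup>2 * (t + e) powr (- 2)"
          unfolding U2 powr_add[symmetric] by (simp add: b_def field_simps)
        also have "\<dots> \<le> U\<^sup>2 * t powr (- 2)" using t e by (intro mult_left_mono powr_mono2') auto
        also have "\<dots> = U\<^sup>2 / t\<^sup>2" unfolding tm2 by simp
        finally have "\<delta> / 16 * (t + e) powr (- real ?n / 2) \<le> \<delta> / 16 * (U\<^sup>2 / t\<^sup>2)" using \<delta>(1) by (intro mult_left_mono) auto
        thus ?thesis by (simp add: mult_ac)
      qed
      finally have neg: "(hyp_laplacian u x)\<^sup>2 - C0 * ((u x)\<^sup>2 / ?R x) \<le> - (\<delta> / 16 * (t + e) powr (- real ?n / 2))" .
      have Jx: "J x = (t + e) powr (- real ?n / 2)" using True by (simp add: J_def norm_eq_sqrt_inner t_def)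
      \<comment> \<open>The second factor is nonpositive, so lowering the density
        \<open>?w x \<ge> 1\<close> to 1 gives an upper bound.\<close>
      have "F x \<le> 1 * ((hyp_laplacian u x)\<^sup>2 - C0 * ((u x)\<^sup>2 / ?R x))"
        unfolding FI using w1(1)
      proof (rule mult_right_mono_neg)
        have "0 \<le> \<delta> / 16 * (t + e) powr (- real ?n / 2)" using \<delta>(1) by simp
        thus "(hyp_laplacian u x)\<^sup>2 - C0 * ((u x)\<^sup>2 / ?R x) \<le> 0" using neg by linarith
      qed
      also have "\<dots> \<le> - (\<delta> / 16 * J x)" using neg by (simp add: Jx)
      also have "\<dots> \<le> G x" using M by (simp add: G_def)
      finally show ?thesis .
    next
      case False
      have "J x = 0" using False by (simp add: J_def norm_eq_sqrt_inner t_def)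
      hence Gx: "G x = M" using nx by (simp add: G_def)
      have "F x \<le> ?w x * (hyp_laplacian u x)\<^sup>2"
        unfolding FI using w1(1) C0p R by (intro mult_left_mono) auto
      also have "\<dots> \<le> 4 ^ ?n * (t0 powr (- (2 * b) - 2) * ((K * k + 4 * C) / 4)\<^sup>2)"
      proof (intro mult_mono w1)
        have "U\<^sup>2 \<le> t0 powr (- (2 * b))" unfolding U2 using False t0(1) e(1) b by (intro powr_mono2') auto
        moreover have "1 / t\<^sup>2 \<le> t0 powr (- 2)"
        proof -
          have "t powr (- 2) \<le> t0 powr (- 2)" using False t0(1) by (intro powr_mono2') auto
          thus ?thesis unfolding tm2 .
        qed
        ultimately have "U\<^sup>2 * (1 / t\<^sup>2) \<le> t0 powr (- (2 * b)) * t0 powr (- 2)" by (intro mult_mono) auto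
        moreover have "(f t * k + 4 * C * t)\<^sup>2 \<le> (K * k + 4 * C)\<^sup>2"
          using fK(1)[of t] f_nonneg[of t] k C t mult_left_mono[of t 1 "4 * C"]
          by (intro power_mono add_mono mult_right_mono add_nonneg_nonneg) auto
        ultimately have "U\<^sup>2 * (1 / t\<^sup>2) * (f t * k + 4 * C * t)\<^sup>2 \<le> t0 powr (- (2 * b)) * t0 powr (- 2) * (K * k + 4 * C)\<^sup>2"
          by (rule mult_mono) auto
        also have "t0 powr (- (2 * b)) * t0 powr (- 2) = t0 powr (- (2 * b) - 2)" by (simp flip: powr_add)
        finally show "(hyp_laplacian u x)\<^sup>2 \<le> t0 powr (- (2 * b) - 2) * ((K * k + 4 * C) / 4)\<^sup>2"
          using hl2 by (simp add: power_divide)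
      qed auto
      finally show ?thesis using Gx by (simp add: M_def)
    qed
  qed
  have "AE x in lborel. F x \<le> G x" using AE_lborel_singleton[of "0::real^'n"] FG by (auto elim: eventually_mono)
  from integral_mono_AE[OF iF iG this] Gneg have "integral\<^sup>L lborel F < 0" by linarith
  thus ?thesis unfolding eF using test_fun_hyp_test_function[OF tu r] by (intro bexI[of _ u]) auto
qed

theorem theorem1p1:
  assumes "CARD('n::finite) \<ge> 5"
  shows
    "(\<forall>u \<in> (hyp_test_functions :: (real^'n \<Rightarrow> real) set).
        integrable hyp_vol
          (\<lambda>x. (u x)\<^sup>2 / hyp_ball_vol_ratio x powr (4 / real CARD('n))) \<and>
        (\<integral>x. (hyp_laplacian u x)\<^sup>2 \<partial>hyp_vol)
          - (real CARD('n) - 1) ^ 4 / 16 * (\<integral>x. (u x)\<^sup>2 \<partial>hyp_vol)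
        \<ge> (real CARD('n))\<^sup>2 * (real CARD('n) - 4)\<^sup>2 / 16
            * (\<integral>x. (u x)\<^sup>2 / hyp_ball_vol_ratio x powr (4 / real CARD('n)) \<partial>hyp_vol)) \<and>
     (\<forall>C > (real CARD('n))\<^sup>2 * (real CARD('n) - 4)\<^sup>2 / 16.
        \<exists>u \<in> (hyp_test_functions :: (real^'n \<Rightarrow> real) set).
        \<not> ((\<integral>x. (hyp_laplacian u x)\<^sup>2 \<partial>hyp_vol)
             - (real CARD('n) - 1) ^ 4 / 16 * (\<integral>x. (u x)\<^sup>2 \<partial>hyp_vol)
           \<ge> C * (\<integral>x. (u x)\<^sup>2 / hyp_ball_vol_ratio x powr (4 / real CARD('n)) \<partial>hyp_vol)))"
proof (intro conjI ballI allI impI)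
  fix u :: "real^'n \<Rightarrow> real"
  assume "u \<in> hyp_test_functions"
  then obtain r where r: "r < 1" "test_fun r u" using hyp_test_function_test_fun by blast
  show "integrable hyp_vol (\<lambda>x. (u x)\<^sup>2 / hyp_ball_vol_ratio x powr (4 / real CARD('n)))"
    by (rule rellich_weight_integrable[OF r(2,1) assms])
  show "(\<integral>x. (hyp_laplacian u x)\<^sup>2 \<partial>hyp_vol) - (real CARD('n) - 1) ^ 4 / 16 * (\<integral>x. (u x)\<^sup>2 \<partial>hyp_vol)
      \<ge> (real CARD('n))\<^sup>2 * (real CARD('n) - 4)\<^sup>2 / 16
          * (\<integral>x. (u x)\<^sup>2 / hyp_ball_vol_ratio x powr (4 / real CARD('n)) \<partial>hyp_vol)"
    by (rule hyp_rellich_inequality[OF r(2,1) assms])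
next
  fix C :: real
  assume C: "C > (real CARD('n))\<^sup>2 * (real CARD('n) - 4)\<^sup>2 / 16"
  obtain u :: "real^'n \<Rightarrow> real" where u: "u \<in> hyp_test_functions"
    "(\<integral>x. (hyp_laplacian u x)\<^sup>2 \<partial>hyp_vol)
      < C * (\<integral>x. (u x)\<^sup>2 / hyp_ball_vol_ratio x powr (4 / real CARD('n)) \<partial>hyp_vol)"
    using hyp_rellich_sharp[OF assms C] by blast
  \<comment> \<open>Subtracting this term lowers the left-hand side further, so the strict
    inequality without it already refutes the constant \<open>C\<close>.\<close>
  moreover have "0 \<le> (real CARD('n) - 1) ^ 4 / 16 * (\<integral>x. (u x)\<^sup>2 \<partial>hyp_vol)"
    by (intro mult_nonneg_nonneg integral_nonneg_AE) auto
  ultimately show "\<exists>u \<in> (hyp_test_functions :: (real^'n \<Rightarrow> real) set).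
        \<not> ((\<integral>x. (hyp_laplacian u x)\<^sup>2 \<partial>hyp_vol)
             - (real CARD('n) - 1) ^ 4 / 16 * (\<integral>x. (u x)\<^sup>2 \<partial>hyp_vol)
           \<ge> C * (\<integral>x. (u x)\<^sup>2 / hyp_ball_vol_ratio x powr (4 / real CARD('n)) \<partial>hyp_vol))"
    by (intro bexI[of _ u]) linarith+
qed

end
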